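(* Let $p\in(1,\infty)$ and let $V_0$ be the set of three vertices of the (two-dimensional standard) Sierpiński gasket $K$. There exists a unique $\rho_p\in(0,\infty)$ such that $\mathcal{R}_{\rho_p,1}(\mathcal{E}_p^{(0)})\big|_{V_0}=\mathcal{E}_p^{(0)}$ for some $p$-resistance form $\mathcal{E}_p^{(0)}$ on $V_0$. Moreover, $\mathcal{E}_p^{(0)}$ can be chosen so as to be $\mathcal{G}_{\mathrm{sym}}$-invariant, i.e., to satisfy $\mathcal{E}_p^{(0)}(u\circ g|_{V_0})=\mathcal{E}_p^{(0)}(u)$ for any $u\in\mathbb{R}^{V_0}$ and any $g\in\mathcal{G}_{\mathrm{sym}}$.
   Context: Notation: $\|x\|_{\ell^s}=(\sum_k|x_k|^s)^{1/s}$ for $s\in(0,\infty)$, $\|x\|_{\ell^\infty}=\max_k|x_k|$; $\mathbf 1_X$ is the constant function $1$ on $X$. $p$-resistance forms on finite sets. For a non-empty finite set $V$, a $p$-resistance form on $V$ is a functional $\mathcal{E}:\mathbb{R}^V\to[0,\infty)$ such that (i) $\mathcal{E}^{1/p}$ is a seminorm on $\mathbb{R}^V$ and $\{u:\mathcal{E}(u)=0\}=\mathbb{R}\mathbf 1_V$; (ii) (generalized contraction property) if $q\in(0,p]$, $r\in[p,\infty]$, $m,n\in\mathbb{N}$ and $T=(T_1,\dots,T_n):\mathbb{R}^m\to\mathbb{R}^n$ satisfies $T(0)=0$ and $\|T(x)-T(y)\|_{\ell^r}\le\|x-y\|_{\ell^q}$ for all $x,y\in\mathbb{R}^m$, then for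 all $u=(u_1,\dots,u_m)\in(\mathbb{R}^V)^m$, $\|(\mathcal{E}(T_k(u))^{1/p})_{k=1}^n\|_{\ell^r}\le\|(\mathcal{E}(u_j)^{1/p})_{j=1}^m\|_{\ell^q}$. Trace: for $\emptyset\ne B\subset V$ and $u\in\mathbb{R}^B$, $\mathcal{E}|_B(u):=\inf\{\mathcal{E}(v)\mid v\in\mathbb{R}^V,\ v|_B=u\}$. Sierpiński gasket: $S=\{1,2,3\}$; $V_0=\{q_1,q_2,q_3\}\subset\mathbb{R}^2$ is the set of vertices of an equilateral triangle; $f_i(x)=q_i+\frac12(x-q_i)$; $K$ is the unique non-empty compact subset of $\mathbb{R}^2$ with $K=\bigcup_{i\in S}f_i(K)$, equipped with the Euclidean metric; $F_i:=f_i|_K$; $V_1:=\bigcup_{i\in S}F_i(V_0)\supset V_0$. $\mathcal{G}_{\mathrm{sym}}$ is the group of isometries of $K$ (each of them maps $V_0$ onto $V_0$). For a $p$-resistance form $\mathcal{E}$ on $V_0$ and $\rho\in(0,\infty)$, $\mathcal{R}_{\rho,1}(\mathcal{E})(u):=\sum_{i\in S}\rho\,\mathcal{E}(u\circ F_i|_{V_0})$ for $u\in\mathbb{R}^{V_1}$ (this is a $p$-resistance form on $V_1$). *)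

theory Defs
  imports "HOL-Analysis.Analysis"
begin

text \<open>
  \<open>\<real>\<^sup>X\<close> is the set of functions extensional on \<open>X\<close>, and \<open>\<real>\<^sup>m\<close> is \<open>\<real>\<^sup>X\<close> with \<open>X = {1..m}\<close>.
  A functional on \<open>\<real>\<^sup>V\<close> is an HOL function on \<^typ>\<open>'a \<Rightarrow> real\<close> of which only the values on
  \<open>\<real>\<^sup>V\<close> are ever used.
\<close>

abbreviation Rfun :: "'a set \<Rightarrow> ('a \<Rightarrow> real) set" where
  "Rfun X \<equiv> extensional X"

text \<open>Only used for \<open>0 < s \<le> \<infinity>\<close> and a finite non-empty index set \<open>I\<close>.\<close>

definition lnorm :: "ereal \<Rightarrow> 'i set \<Rightarrow> ('i \<Rightarrow> real) \<Rightarrow> real" where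
  "lnorm s I x =
     (if s = \<infinity> then Max ((\<lambda>k. \<bar>x k\<bar>) ` I)
      else (\<Sum>k\<in>I. \<bar>x k\<bar> powr real_of_ereal s) powr (1 / real_of_ereal s))"

definition seminorm_on :: "'a set \<Rightarrow> (('a \<Rightarrow> real) \<Rightarrow> real) \<Rightarrow> bool" where
  "seminorm_on V N \<longleftrightarrow>
     (\<forall>u\<in>Rfun V. 0 \<le> N u) \<and>
     (\<forall>c. \<forall>u\<in>Rfun V. N (\<lambda>x\<in>V. c * u x) = \<bar>c\<bar> * N u) \<and>
     (\<forall>u\<in>Rfun V. \<forall>v\<in>Rfun V. N (\<lambda>x\<in>V. u x + v x) \<le> N u + N v)"

definition generalized_contraction :: "real \<Rightarrow> 'a set \<Rightarrow> (('a \<Rightarrow> real) \<Rightarrow> real) \<Rightarrow> bool" where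
  "generalized_contraction p V E \<longleftrightarrow>
     (\<forall>(s::ereal) (r::ereal) (m::nat) (n::nat) (T :: (nat \<Rightarrow> real) \<Rightarrow> nat \<Rightarrow> real).
        0 < s \<and> s \<le> ereal p \<and> ereal p \<le> r \<and> 1 \<le> m \<and> 1 \<le> n \<and>
        T \<in> Rfun {1..m} \<rightarrow> Rfun {1..n} \<and>
        T (\<lambda>j\<in>{1..m}. 0) = (\<lambda>k\<in>{1..n}. 0) \<and>
        (\<forall>x\<in>Rfun {1..m}. \<forall>y\<in>Rfun {1..m}.
           lnorm r {1..n} (\<lambda>k. T x k - T y k) \<le> lnorm s {1..m} (\<lambda>j. x j - y j))
        \<longrightarrow> (\<forall>u :: nat \<Rightarrow> 'a \<Rightarrow> real. (\<forall>j\<in>{1..m}. u j \<in> Rfun V) \<longrightarrow>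
              lnorm r {1..n} (\<lambda>k. E (\<lambda>x\<in>V. T (\<lambda>j\<in>{1..m}. u j x) k) powr (1 / p))
                \<le> lnorm s {1..m} (\<lambda>j. E (u j) powr (1 / p))))"

definition resistance_form :: "real \<Rightarrow> 'a set \<Rightarrow> (('a \<Rightarrow> real) \<Rightarrow> real) \<Rightarrow> bool" where
  "resistance_form p V E \<longleftrightarrow>
     finite V \<and> V \<noteq> {} \<and>
     (\<forall>u\<in>Rfun V. 0 \<le> E u) \<and>
     seminorm_on V (\<lambda>u. E u powr (1 / p)) \<and>
     {u \<in> Rfun V. E u = 0} = range (\<lambda>c::real. \<lambda>x\<in>V. c) \<and>
     generalized_contraction p V E"

text \<open>The trace on \<open>B\<close> of a form \<open>E\<close> on \<open>V\<close>, for non-empty \<open>B \<subseteq> V\<close>.\<close>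

definition form_trace ::
  "'a set \<Rightarrow> 'a set \<Rightarrow> (('a \<Rightarrow> real) \<Rightarrow> real) \<Rightarrow> ('a \<Rightarrow> real) \<Rightarrow> real" where
  "form_trace V B E u = Inf {E v | v. v \<in> Rfun V \<and> restrict v B = u}"

definition equilateral :: "(nat \<Rightarrow> real^2) \<Rightarrow> bool" where
  "equilateral q \<longleftrightarrow>
     (\<exists>d>0. \<forall>i\<in>{1,2,3}. \<forall>j\<in>{1,2,3}. i \<noteq> j \<longrightarrow> dist (q i) (q j) = d)"

definition sg_map :: "(nat \<Rightarrow> real^2) \<Rightarrow> nat \<Rightarrow> real^2 \<Rightarrow> real^2" where
  "sg_map q i x = q i + (1/2) *\<^sub>R (x - q i)"

definition sg_gasket :: "(nat \<Rightarrow> real^2) \<Rightarrow> (real^2) set" where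
  "sg_gasket q =
     (THE K. K \<noteq> {} \<and> compact K \<and> K = (\<Union>i\<in>{1,2,3}. sg_map q i ` K))"

definition sg_V0 :: "(nat \<Rightarrow> real^2) \<Rightarrow> (real^2) set" where
  "sg_V0 q = q ` {1,2,3}"

text \<open>
  The vertices lie in the gasket, so on them the restriction \<open>F\<^sub>i\<close> of \<open>f\<^sub>i =\<close> \<^const>\<open>sg_map\<close> \<open>q i\<close>
  to the gasket agrees with \<open>f\<^sub>i\<close>; below \<open>f\<^sub>i\<close> is used directly.
\<close>

definition sg_V1 :: "(nat \<Rightarrow> real^2) \<Rightarrow> (real^2) set" where
  "sg_V1 q = (\<Union>i\<in>{1,2,3}. sg_map q i ` sg_V0 q)"

definition sg_renorm ::
  "(nat \<Rightarrow> real^2) \<Rightarrow> real \<Rightarrow> ((real^2 \<Rightarrow> real) \<Rightarrow> real) \<Rightarrow> (real^2 \<Rightarrow> real) \<Rightarrow> real" where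
  "sg_renorm q \<rho> E u = (\<Sum>i\<in>{1,2,3}. \<rho> * E (\<lambda>x\<in>sg_V0 q. u (sg_map q i x)))"

text \<open>Isometries of the gasket; the values of \<open>g\<close> outside the gasket are irrelevant.\<close>

definition sg_sym :: "(nat \<Rightarrow> real^2) \<Rightarrow> (real^2 \<Rightarrow> real^2) set" where
  "sg_sym q = {g. bij_betw g (sg_gasket q) (sg_gasket q) \<and>
     (\<forall>x\<in>sg_gasket q. \<forall>y\<in>sg_gasket q. dist (g x) (g y) = dist x y)}"

definition sg_eigenform ::
  "real \<Rightarrow> (nat \<Rightarrow> real^2) \<Rightarrow> real \<Rightarrow> ((real^2 \<Rightarrow> real) \<Rightarrow> real) \<Rightarrow> bool" where
  "sg_eigenform p q \<rho> E \<longleftrightarrow>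
     resistance_form p (sg_V0 q) E \<and>
     (\<forall>u\<in>Rfun (sg_V0 q). form_trace (sg_V1 q) (sg_V0 q) (sg_renorm q \<rho> E) u = E u)"

definition sg_invariant ::
  "(nat \<Rightarrow> real^2) \<Rightarrow> ((real^2 \<Rightarrow> real) \<Rightarrow> real) \<Rightarrow> bool" where
  "sg_invariant q E \<longleftrightarrow>
     (\<forall>u\<in>Rfun (sg_V0 q). \<forall>g\<in>sg_sym q. E (\<lambda>x\<in>sg_V0 q. u (g x)) = E u)"

end

theory Submission
  imports Defs
begin

text \<open>
  Encode a form on \<open>V\<^sub>0\<close> as a function \<open>D\<close> of three reals, and let \<open>R D\<close> be the trace on \<open>V\<^sub>0\<close> of the sum of
  the three copies of \<open>D\<close> on the cells. The generalized contraction property survives sums (Minkowski's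
  inequality, and its reverse for exponents below 1), traces and pointwise limits. Symmetric forms are
  comparable to each other with constants depending on \<open>p\<close> only, so the normalised ones form a compact set and
  the largest \<open>L\<close> with \<open>R A \<ge> L A\<close> for some symmetric \<open>A\<close> is attained. The iterates of \<open>R / L\<close> on \<open>A\<close>
  increase, stay bounded by maximality of \<open>L\<close>, and converge to a symmetric eigenform; thus \<open>\<rho> = 1 / L\<close>.
  Any two nondegenerate forms are comparable, and iterating \<open>R\<close> on such a comparison of two eigenforms shows
  that \<open>\<rho>\<close> is unique.
\<close>

subsection \<open>Minkowski inequalities\<close>

text \<open>This is a nonlinear Perron-Frobenius argument: \<open>renorm3\<close> is monotone and
  homogeneous of degree 1 on the cone of forms. A form is treated as its family of values
  \<open>D w\<close>, one coordinate for each triple \<open>w\<close>, and compactness is that of a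
  product of intervals. Symmetry supplies the uniform control: up to the factor
  \<open>4 powr p\<close>, a symmetric form is determined by its value at \<open>(1, 0, 0)\<close>,
  and the trace preserves symmetry. The obstacle is that a trace is an infimum, which need not
  commute with pointwise limits. Hence the inequality defining the largest \<open>L\<close> is
  stated for every choice of midpoint values, before the infimum is taken. Only the limit of the
  iterates needs an exchange of limit and infimum; there the bounds on the edges keep
  near-minimisers in a compact box.\<close>

lemma powr_le_tangent:
  fixes t \<theta> :: real
  assumes "0 < \<theta>" "\<theta> \<le> 1" "0 \<le> t"
  shows "t powr \<theta> \<le> 1 + \<theta> * (t - 1)"
proof (cases "t = 0")
  case True
  then show ?thesis using assms by simp
next
  case False
  then have "0 < t" using assms by simp
  \<comment> \<open>For positive t, \<open>t powr \<theta>\<close> is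
    \<open>exp (\<theta> * ln t)\<close>, so the claim is convexity of \<open>exp\<close> between 0
    and \<open>ln t\<close>.\<close>
  have "exp ((1 - \<theta>) *\<^sub>R 0 + \<theta> *\<^sub>R ln t) \<le> (1 - \<theta>) * exp 0 + \<theta> * exp (ln t)"
    by (rule convex_onD[OF exp_convex]) (use assms in auto)
  with \<open>0 < t\<close> show ?thesis by (simp add: powr_def algebra_simps)
qed

text \<open>The concave case, applied to \<open>t powr \<theta>\<close> with exponent
  \<open>1 / \<theta>\<close>, solved for \<open>t powr \<theta>\<close>.\<close>

lemma powr_ge_tangent:
  fixes t \<theta> :: real
  assumes "1 \<le> \<theta>" "0 \<le> t"
  shows "1 + \<theta> * (t - 1) \<le> t powr \<theta>"
proof -
  have "(t powr \<theta>) powr (1 / \<theta>) \<le> 1 + (1 / \<theta>) * (t powr \<theta> - 1)"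
    by (rule powr_le_tangent) (use assms in auto)
  then have "t \<le> 1 + (1 / \<theta>) * (t powr \<theta> - 1)" using assms by (simp add: powr_powr)
  then show ?thesis using assms by (simp add: field_simps)
qed

text \<open>Jensen's inequality for the power function: after division by the mean \<open>s\<close>,
  add up the tangent inequalities at 1; by \<open>mean\<close> the linear terms cancel.\<close>

lemma powr_weighted_mean:
  fixes a b l m \<theta> :: real
  assumes ab: "0 \<le> a" "0 \<le> b" "0 < l" "0 < m" "l + m = 1" and "0 < \<theta>"
  shows "1 \<le> \<theta> \<Longrightarrow> (l * a + m * b) powr \<theta> \<le> l * a powr \<theta> + m * b powr \<theta>"
    and "\<theta> \<le> 1 \<Longrightarrow> l * a powr \<theta> + m * b powr \<theta> \<le> (l * a + m * b) powr \<theta>"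
proof -
  define s where "s = l * a + m * b"
  have "0 \<le> s" using ab unfolding s_def by simp
  have split: "x powr \<theta> = s powr \<theta> * (x / s) powr \<theta>" if "0 < s" "0 \<le> x" for x
    using that by (simp add: powr_divide)
  have mean: "l * (1 + \<theta> * (a / s - 1)) + m * (1 + \<theta> * (b / s - 1)) = 1" if "0 < s"
  proof -
    have "l * (a / s) + m * (b / s) = 1"
      using that unfolding s_def by (metis add_divide_distrib div_self less_irrefl times_divide_eq_right)
    moreover have "l * (1 + \<theta> * (a / s - 1)) + m * (1 + \<theta> * (b / s - 1))
       = (l + m) + \<theta> * ((l * (a / s) + m * (b / s)) - (l + m))" by (simp add: algebra_simps)
    ultimately show ?thesis using ab by simp
  qed
  have zero: "a = 0 \<and> b = 0" if "s = 0"
    using that ab unfolding s_def by (simp add: add_nonneg_eq_0_iff)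
  show "(l * a + m * b) powr \<theta> \<le> l * a powr \<theta> + m * b powr \<theta>" if "1 \<le> \<theta>"
  proof (cases "s = 0")
    case True then show ?thesis using ab zero by simp
  next
    case False
    with \<open>0 \<le> s\<close> have "0 < s" by simp
    have "l * (1 + \<theta> * (a / s - 1)) + m * (1 + \<theta> * (b / s - 1)) \<le> l * (a / s) powr \<theta> + m * (b / s) powr \<theta>"
      by (intro add_mono mult_left_mono powr_ge_tangent) (use that ab \<open>0 < s\<close> in auto)
    then have "s powr \<theta> * 1 \<le> s powr \<theta> * (l * (a / s) powr \<theta> + m * (b / s) powr \<theta>)"
      unfolding mean[OF \<open>0 < s\<close>] by (intro mult_left_mono) auto
    also have "\<dots> = l * a powr \<theta> + m * b powr \<theta>"
      using split[OF \<open>0 < s\<close>, of a] split[OF \<open>0 < s\<close>, of b] ab by (simp add: algebra_simps)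
    finally show ?thesis by (simp add: s_def)
  qed
  show "l * a powr \<theta> + m * b powr \<theta> \<le> (l * a + m * b) powr \<theta>" if "\<theta> \<le> 1"
  proof (cases "s = 0")
    case True then show ?thesis using ab zero by simp
  next
    case False
    with \<open>0 \<le> s\<close> have "0 < s" by simp
    have "l * (a / s) powr \<theta> + m * (b / s) powr \<theta> \<le> l * (1 + \<theta> * (a / s - 1)) + m * (1 + \<theta> * (b / s - 1))"
      by (intro add_mono mult_left_mono powr_le_tangent) (use that ab \<open>0 < s\<close> \<open>0 < \<theta>\<close> in auto)
    then have "s powr \<theta> * (l * (a / s) powr \<theta> + m * (b / s) powr \<theta>) \<le> s powr \<theta> * 1"
      unfolding mean[OF \<open>0 < s\<close>] by (intro mult_left_mono) auto
    moreover have "s powr \<theta> * (l * (a / s) powr \<theta> + m * (b / s) powr \<theta>) = l * a powr \<theta> + m * b powr \<theta>"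
      using split[OF \<open>0 < s\<close>, of a] split[OF \<open>0 < s\<close>, of b] ab by (simp add: algebra_simps)
    ultimately show ?thesis by (simp add: s_def)
  qed
qed

text \<open>Write x + y as (X + Y) times the convex combination of x / X and y / Y with weights
  \<open>l\<close> and \<open>m\<close>. Jensen in each coordinate then gives both directions, since
  the normalised vectors have power sum 1. The division forces the case X = 0 or Y = 0 to be treated
  apart.\<close>

lemma minkowski_powr_sum:
  fixes x y :: "'i \<Rightarrow> real" and \<theta> :: real
  assumes "finite I" and x: "\<And>i. i \<in> I \<Longrightarrow> 0 \<le> x i" and y: "\<And>i. i \<in> I \<Longrightarrow> 0 \<le> y i" and "0 < \<theta>"
  shows "1 \<le> \<theta> \<Longrightarrow> (\<Sum>i\<in>I. (x i + y i) powr \<theta>) powr (1 / \<theta>)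
      \<le> (\<Sum>i\<in>I. x i powr \<theta>) powr (1 / \<theta>) + (\<Sum>i\<in>I. y i powr \<theta>) powr (1 / \<theta>)"
    and "\<theta> \<le> 1 \<Longrightarrow> (\<Sum>i\<in>I. x i powr \<theta>) powr (1 / \<theta>) + (\<Sum>i\<in>I. y i powr \<theta>) powr (1 / \<theta>)
      \<le> (\<Sum>i\<in>I. (x i + y i) powr \<theta>) powr (1 / \<theta>)"
proof -
  define X Y where "X = (\<Sum>i\<in>I. x i powr \<theta>) powr (1 / \<theta>)" and "Y = (\<Sum>i\<in>I. y i powr \<theta>) powr (1 / \<theta>)"
  define Z where "Z = (\<Sum>i\<in>I. (x i + y i) powr \<theta>)"
  have Xp: "X powr \<theta> = (\<Sum>i\<in>I. x i powr \<theta>)" and Yp: "Y powr \<theta> = (\<Sum>i\<in>I. y i powr \<theta>)"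
    unfolding X_def Y_def using \<open>0 < \<theta>\<close> by (simp_all add: powr_powr sum_nonneg)
  have "0 \<le> X" "0 \<le> Y" "0 \<le> Z" unfolding X_def Y_def Z_def by (auto intro: sum_nonneg)
  have z0: "\<And>i. i \<in> I \<Longrightarrow> x i = 0" if "X = 0"
    using that Xp \<open>finite I\<close> by (simp add: sum_nonneg_eq_0_iff)
  have w0: "\<And>i. i \<in> I \<Longrightarrow> y i = 0" if "Y = 0"
    using that Yp \<open>finite I\<close> by (simp add: sum_nonneg_eq_0_iff)
  have degenerate: "Z powr (1 / \<theta>) = X + Y" if "X = 0 \<or> Y = 0"
    using that
  proof
    assume "X = 0"
    then have "Z = (\<Sum>i\<in>I. y i powr \<theta>)" unfolding Z_def using z0 by (intro sum.cong) auto
    then show ?thesis using \<open>X = 0\<close> by (simp add: Y_def)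
  next
    assume "Y = 0"
    then have "Z = (\<Sum>i\<in>I. x i powr \<theta>)" unfolding Z_def using w0 by (intro sum.cong) auto
    then show ?thesis using \<open>Y = 0\<close> by (simp add: X_def)
  qed
  define l m where "l = X / (X + Y)" and "m = Y / (X + Y)"
  have scaled: "Z = (X + Y) powr \<theta> * (\<Sum>i\<in>I. (l * (x i / X) + m * (y i / Y)) powr \<theta>)"
      "(\<Sum>i\<in>I. l * (x i / X) powr \<theta> + m * (y i / Y) powr \<theta>) = 1" "0 < l" "0 < m" "l + m = 1"
    if "0 < X" "0 < Y"
  proof -
    show lm: "0 < l" "0 < m" "l + m = 1" unfolding l_def m_def using that
      by (simp_all add: add_divide_distrib[symmetric])
    have "x i + y i = (X + Y) * (l * (x i / X) + m * (y i / Y))" for i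
    proof -
      have "l * (x i / X) = x i / (X + Y)" "m * (y i / Y) = y i / (X + Y)"
        unfolding l_def m_def using that by simp_all
      then show ?thesis using that by (simp add: add_divide_distrib[symmetric])
    qed
    moreover have "0 \<le> l * (x i / X) + m * (y i / Y)" if "i \<in> I" for i
      using lm x y that \<open>0 < X\<close> \<open>0 < Y\<close> by auto
    ultimately show "Z = (X + Y) powr \<theta> * (\<Sum>i\<in>I. (l * (x i / X) + m * (y i / Y)) powr \<theta>)"
      unfolding Z_def sum_distrib_left using that by (intro sum.cong) (auto simp: powr_mult)
    have "(\<Sum>i\<in>I. (x i / X) powr \<theta>) = 1" "(\<Sum>i\<in>I. (y i / Y) powr \<theta>) = 1"
      using that x y by (simp_all add: powr_divide sum_divide_distrib[symmetric] Xp[symmetric] Yp[symmetric])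
    then show "(\<Sum>i\<in>I. l * (x i / X) powr \<theta> + m * (y i / Y) powr \<theta>) = 1"
      using lm by (simp add: sum.distrib sum_distrib_left[symmetric])
  qed
  have XY: "((X + Y) powr \<theta>) powr (1 / \<theta>) = X + Y"
    using \<open>0 < \<theta>\<close> \<open>0 \<le> X\<close> \<open>0 \<le> Y\<close> by (simp add: powr_powr)
  show "Z powr (1 / \<theta>) \<le> X + Y" if "1 \<le> \<theta>"
  proof (cases "X = 0 \<or> Y = 0")
    case False
    then have "0 < X" "0 < Y" using \<open>0 \<le> X\<close> \<open>0 \<le> Y\<close> by auto
    note s = scaled[OF this]
    have "(\<Sum>i\<in>I. (l * (x i / X) + m * (y i / Y)) powr \<theta>) \<le> (\<Sum>i\<in>I. l * (x i / X) powr \<theta> + m * (y i / Y) powr \<theta>)"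
      by (intro sum_mono powr_weighted_mean(1)) (use s x y \<open>0 < X\<close> \<open>0 < Y\<close> that in auto)
    then have "Z \<le> (X + Y) powr \<theta>" unfolding s(1) s(2) by (simp add: mult_left_le)
    then show ?thesis using powr_mono2[of "1 / \<theta>" Z "(X + Y) powr \<theta>"] \<open>0 < \<theta>\<close> \<open>0 \<le> Z\<close> XY by simp
  qed (use degenerate in simp)
  show "X + Y \<le> Z powr (1 / \<theta>)" if "\<theta> \<le> 1"
  proof (cases "X = 0 \<or> Y = 0")
    case False
    then have "0 < X" "0 < Y" using \<open>0 \<le> X\<close> \<open>0 \<le> Y\<close> by auto
    note s = scaled[OF this]
    have "(\<Sum>i\<in>I. l * (x i / X) powr \<theta> + m * (y i / Y) powr \<theta>) \<le> (\<Sum>i\<in>I. (l * (x i / X) + m * (y i / Y)) powr \<theta>)"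
      by (intro sum_mono powr_weighted_mean(2)) (use s x y \<open>0 < X\<close> \<open>0 < Y\<close> \<open>0 < \<theta>\<close> that in auto)
    then have "(X + Y) powr \<theta> \<le> Z" unfolding s(1) s(2)
      using mult_left_mono[of 1 _ "(X + Y) powr \<theta>"] by simp
    then show ?thesis using powr_mono2[of "1 / \<theta>" "(X + Y) powr \<theta>" Z] \<open>0 < \<theta>\<close> XY by simp
  qed (use degenerate in simp)
qed

section \<open>Calculus of \<open>lnorm\<close> for arbitrary positive exponents, including
  infinity\<close>

lemma lnorm_ereal:
  "lnorm (ereal a) I x = (\<Sum>k\<in>I. \<bar>x k\<bar> powr a) powr (1 / a)"
  by (simp add: lnorm_def)

lemma lnorm_PInfty: "lnorm \<infinity> I x = Max ((\<lambda>k. \<bar>x k\<bar>) ` I)"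
  by (simp add: lnorm_def)

lemma ereal_exponent_cases:
  assumes "0 < (s::ereal)"
  obtains a where "s = ereal a" "0 < a" | "s = \<infinity>"
  using assms by (cases s) auto

lemma lnorm_cong: "(\<And>k. k \<in> I \<Longrightarrow> x k = y k) \<Longrightarrow> lnorm s I x = lnorm s I y"
  unfolding lnorm_def by (auto cong: image_cong sum.cong)

lemma lnorm_nonneg:
  assumes "finite I" "I \<noteq> {}" shows "0 \<le> lnorm s I x"
proof (cases "s = \<infinity>")
  case True
  obtain k where "k \<in> I" using assms by auto
  then show ?thesis using True assms by (auto simp: lnorm_def Max_ge_iff intro!: bexI[of _ k])
qed (simp add: lnorm_def)

lemma lnorm_mono:
  assumes "finite I" "I \<noteq> {}" "0 < s" "\<And>k. k \<in> I \<Longrightarrow> \<bar>x k\<bar> \<le> \<bar>y k\<bar>"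
  shows "lnorm s I x \<le> lnorm s I y"
  using \<open>0 < s\<close>
proof (cases rule: ereal_exponent_cases)
  case (1 a)
  then show ?thesis using assms by (auto simp: lnorm_ereal intro!: powr_mono2 sum_mono sum_nonneg)
next
  case 2
  have "\<bar>x k\<bar> \<le> Max ((\<lambda>k. \<bar>y k\<bar>) ` I)" if "k \<in> I" for k
    using assms(4)[OF that] assms(1) that by (meson Max_ge finite_imageI imageI order_trans)
  then show ?thesis using 2 assms by (simp add: lnorm_PInfty)
qed

lemma lnorm_scale:
  assumes "finite I" "I \<noteq> {}" "0 < s"
  shows "lnorm s I (\<lambda>k. c * x k) = \<bar>c\<bar> * lnorm s I x"
  using \<open>0 < s\<close>
proof (cases rule: ereal_exponent_cases)
  case (1 a)
  then show ?thesis
    by (simp add: lnorm_ereal abs_mult powr_mult sum_distrib_left[symmetric] sum_nonneg powr_powr)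
next
  case 2
  have "Max ((\<lambda>k. \<bar>c\<bar> * \<bar>x k\<bar>) ` I) = \<bar>c\<bar> * Max ((\<lambda>k. \<bar>x k\<bar>) ` I)"
    using mono_Max_commute[of "\<lambda>t. \<bar>c\<bar> * t" "(\<lambda>k. \<bar>x k\<bar>) ` I"] assms
    by (simp add: image_image mono_def mult_left_mono)
  then show ?thesis using 2 by (simp add: lnorm_PInfty abs_mult)
qed

lemma tendsto_Max_image:
  fixes f :: "'i \<Rightarrow> 'b \<Rightarrow> real"
  assumes "finite I" "I \<noteq> {}" "\<And>k. k \<in> I \<Longrightarrow> ((\<lambda>n. f k n) \<longlongrightarrow> l k) F"
  shows "((\<lambda>n. Max ((\<lambda>k. f k n) ` I)) \<longlongrightarrow> Max (l ` I)) F"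
  using assms
proof (induction I rule: finite_ne_induct)
  case (insert k I)
  then show ?case by (simp add: tendsto_max)
qed simp

lemma tendsto_lnorm:
  fixes f :: "'i \<Rightarrow> 'b \<Rightarrow> real"
  assumes "finite I" "I \<noteq> {}" "0 < s" and lim: "\<And>k. k \<in> I \<Longrightarrow> ((\<lambda>n. f k n) \<longlongrightarrow> l k) F"
  shows "((\<lambda>n. lnorm s I (\<lambda>k. f k n)) \<longlongrightarrow> lnorm s I l) F"
  using \<open>0 < s\<close>
proof (cases rule: ereal_exponent_cases)
  case (1 a)
  then show ?thesis unfolding 1 lnorm_ereal using lim
    by (intro tendsto_powr' tendsto_sum tendsto_rabs tendsto_const) (auto intro!: sum_nonneg always_eventually)
next
  case 2
  then show ?thesis unfolding 2 lnorm_PInfty using assms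
    by (intro tendsto_Max_image tendsto_rabs) auto
qed

text \<open>The p-th power of the r-norm of p-th roots is the norm with exponent
  \<open>\<theta> = r / p \<ge> 1\<close> of the vector itself, so this is Minkowski's inequality.
  For infinite r it becomes subadditivity of the maximum.\<close>

lemma lnorm_powr_add_le:
  assumes "finite I" "I \<noteq> {}" "0 < p" "ereal p \<le> r"
    and X: "\<And>k. k \<in> I \<Longrightarrow> 0 \<le> X k" and Y: "\<And>k. k \<in> I \<Longrightarrow> 0 \<le> Y k"
  shows "lnorm r I (\<lambda>k. (X k + Y k) powr (1 / p)) powr p
    \<le> lnorm r I (\<lambda>k. X k powr (1 / p)) powr p + lnorm r I (\<lambda>k. Y k powr (1 / p)) powr p"
proof -
  have "0 < r" using assms(3,4) by (metis ereal_less(2) less_le_trans)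
  then show ?thesis
  proof (cases rule: ereal_exponent_cases)
    case (1 a)
    define \<theta> where "\<theta> = a / p"
    have "p \<le> a" using assms 1 by simp
    then have "1 \<le> \<theta>" using \<open>0 < p\<close> by (simp add: \<theta>_def)
    have e: "lnorm r I (\<lambda>k. Z k powr (1 / p)) powr p = (\<Sum>k\<in>I. Z k powr \<theta>) powr (1 / \<theta>)" for Z
      using \<open>0 < p\<close> by (simp add: 1 lnorm_ereal powr_powr \<theta>_def)
    show ?thesis unfolding e
      by (rule minkowski_powr_sum(1)) (use assms \<open>1 \<le> \<theta>\<close> in auto)
  next
    case 2
    have e: "lnorm r I (\<lambda>k. Z k powr (1 / p)) powr p = Max (Z ` I)" if "\<And>k. k \<in> I \<Longrightarrow> 0 \<le> Z k" for Z
    proof -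
      have "Max (Z ` I) \<in> Z ` I" using assms by simp
      then have "0 \<le> Max (Z ` I)" using that by auto
      \<comment> \<open>\<open>mono_Max_commute\<close> asks for a map monotone on all reals, hence
        the truncation at 0.\<close>
      have "mono (\<lambda>t::real. max 0 t powr (1 / p))"
        using \<open>0 < p\<close> by (intro monoI powr_mono2) auto
      then have "Max ((\<lambda>k. max 0 (Z k) powr (1 / p)) ` I) = max 0 (Max (Z ` I)) powr (1 / p)"
        using mono_Max_commute[of "\<lambda>t. max 0 t powr (1 / p)" "Z ` I"] assms
        by (simp add: image_image)
      moreover have "(\<lambda>k. max 0 (Z k) powr (1 / p)) ` I = (\<lambda>k. Z k powr (1 / p)) ` I"
        using that by (intro image_cong) auto
      ultimately show ?thesis using \<open>0 \<le> Max (Z ` I)\<close> \<open>0 < p\<close> by (simp add: 2 lnorm_PInfty powr_powr)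
    qed
    have "X k + Y k \<le> Max (X ` I) + Max (Y ` I)" if "k \<in> I" for k
      using that assms by (intro add_mono Max_ge) auto
    then show ?thesis using assms by (subst (1 2 3) e) auto
  qed
qed

text \<open>Now \<open>\<theta> = s / p \<le> 1\<close>, and Minkowski's inequality is
  reversed.\<close>

lemma lnorm_powr_add_ge:
  assumes "finite I" "I \<noteq> {}" "0 < p" "0 < s" "s \<le> ereal p"
    and X: "\<And>k. k \<in> I \<Longrightarrow> 0 \<le> X k" and Y: "\<And>k. k \<in> I \<Longrightarrow> 0 \<le> Y k"
  shows "lnorm s I (\<lambda>k. X k powr (1 / p)) powr p + lnorm s I (\<lambda>k. Y k powr (1 / p)) powr p
    \<le> lnorm s I (\<lambda>k. (X k + Y k) powr (1 / p)) powr p"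
proof -
  obtain a where 1: "s = ereal a" "0 < a" using assms(4,5) by (cases s) auto
  define \<theta> where "\<theta> = a / p"
  have "a \<le> p" using assms 1 by simp
  then have "0 < \<theta>" "\<theta> \<le> 1" using \<open>0 < p\<close> 1 by (simp_all add: \<theta>_def)
  have e: "lnorm s I (\<lambda>k. Z k powr (1 / p)) powr p = (\<Sum>k\<in>I. Z k powr \<theta>) powr (1 / \<theta>)" for Z
    using \<open>0 < p\<close> by (simp add: 1 lnorm_ereal powr_powr \<theta>_def)
  show ?thesis unfolding e
    by (rule minkowski_powr_sum(2)) (use assms \<open>0 < \<theta>\<close> \<open>\<theta> \<le> 1\<close> in auto)
qed

text \<open>Here it matters that the two exponents lie on opposite sides of p: p-th powers are
  subadditive on the r-side and superadditive on the s-side, so two contraction inequalities can be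
  added.\<close>

lemma lnorm_contraction_add:
  assumes fin: "finite I" "I \<noteq> {}" "finite J" "J \<noteq> {}" and e: "0 < p" "0 < s" "s \<le> ereal p" "ereal p \<le> r"
    and nonneg: "\<And>k. k \<in> I \<Longrightarrow> 0 \<le> X k" "\<And>k. k \<in> I \<Longrightarrow> 0 \<le> X' k"
      "\<And>j. j \<in> J \<Longrightarrow> 0 \<le> Y j" "\<And>j. j \<in> J \<Longrightarrow> 0 \<le> Y' j"
    and le: "lnorm r I (\<lambda>k. X k powr (1 / p)) \<le> lnorm s J (\<lambda>j. Y j powr (1 / p))"
      "lnorm r I (\<lambda>k. X' k powr (1 / p)) \<le> lnorm s J (\<lambda>j. Y' j powr (1 / p))"
  shows "lnorm r I (\<lambda>k. (X k + X' k) powr (1 / p)) \<le> lnorm s J (\<lambda>j. (Y j + Y' j) powr (1 / p))"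
    (is "?l \<le> ?r")
proof -
  have "?l powr p \<le> lnorm r I (\<lambda>k. X k powr (1 / p)) powr p + lnorm r I (\<lambda>k. X' k powr (1 / p)) powr p"
    by (rule lnorm_powr_add_le) (use assms in auto)
  also have "\<dots> \<le> lnorm s J (\<lambda>j. Y j powr (1 / p)) powr p + lnorm s J (\<lambda>j. Y' j powr (1 / p)) powr p"
    by (intro add_mono powr_mono2 le) (use \<open>0 < p\<close> in \<open>auto intro: lnorm_nonneg[OF fin(1,2)]\<close>)
  also have "\<dots> \<le> ?r powr p"
    by (rule lnorm_powr_add_ge) (use assms in auto)
  finally have "(?l powr p) powr (1 / p) \<le> (?r powr p) powr (1 / p)"
    using \<open>0 < p\<close> by (intro powr_mono2[of "1 / p"]) auto
  then show ?thesis using lnorm_nonneg[OF fin(1,2)] lnorm_nonneg[OF fin(3,4)] \<open>0 < p\<close>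
    by (simp add: powr_powr)
qed

subsection \<open>Forms in three values\<close>

text \<open>Syntactically the premise on \<open>T\<close> in \<open>generalized_contraction\<close>,
  so that the two can be exchanged by unfolding.\<close>

definition lnorm_contraction ::
  "real \<Rightarrow> ereal \<Rightarrow> ereal \<Rightarrow> nat \<Rightarrow> nat \<Rightarrow> ((nat \<Rightarrow> real) \<Rightarrow> nat \<Rightarrow> real) \<Rightarrow> bool" where
  "lnorm_contraction p s r m n T \<longleftrightarrow>
     0 < s \<and> s \<le> ereal p \<and> ereal p \<le> r \<and> 1 \<le> m \<and> 1 \<le> n \<and>
     T \<in> Rfun {1..m} \<rightarrow> Rfun {1..n} \<and>
     T (\<lambda>j\<in>{1..m}. 0) = (\<lambda>k\<in>{1..n}. 0) \<and>
     (\<forall>x\<in>Rfun {1..m}. \<forall>y\<in>Rfun {1..m}.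
        lnorm r {1..n} (\<lambda>k. T x k - T y k) \<le> lnorm s {1..m} (\<lambda>j. x j - y j))"

text \<open>The vectors \<open>x\<close>, \<open>y\<close>, \<open>z\<close> hold the values of all
  m functions at one vertex each, so \<open>T\<close> acts on every vertex separately.\<close>

definition contraction3 :: "real \<Rightarrow> (real \<times> real \<times> real \<Rightarrow> real) \<Rightarrow> bool" where
  "contraction3 p D \<longleftrightarrow>
     (\<forall>s r m n T. lnorm_contraction p s r m n T \<longrightarrow>
       (\<forall>x\<in>Rfun {1..m}. \<forall>y\<in>Rfun {1..m}. \<forall>z\<in>Rfun {1..m}.
          lnorm r {1..n} (\<lambda>k. D (T x k, T y k, T z k) powr (1 / p))
            \<le> lnorm s {1..m} (\<lambda>j. D (x j, y j, z j) powr (1 / p))))"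

text \<open>A possibly degenerate \<open>p\<close>-resistance form on \<open>V\<^sub>0\<close>: the triple is \<open>(u q\<^sub>1, u q\<^sub>2, u q\<^sub>3)\<close>.\<close>

definition form3 :: "real \<Rightarrow> (real \<times> real \<times> real \<Rightarrow> real) \<Rightarrow> bool" where
  "form3 p D \<longleftrightarrow> 1 < p \<and> (\<forall>w. 0 \<le> D w) \<and>
     (\<forall>c w. D (c *\<^sub>R w) = \<bar>c\<bar> powr p * D w) \<and> (\<forall>c. D (c, c, c) = 0) \<and> contraction3 p D"

definition symmetric3 :: "(real \<times> real \<times> real \<Rightarrow> real) \<Rightarrow> bool" where
  "symmetric3 D \<longleftrightarrow> (\<forall>x y z. D (y, x, z) = D (x, y, z) \<and> D (x, z, y) = D (x, y, z))"

lemma form3D: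
  assumes "form3 p D"
  shows "1 < p" "0 \<le> D w" "D (c *\<^sub>R w) = \<bar>c\<bar> powr p * D w" "D (c, c, c) = 0"
  using assms unfolding form3_def by blast+

lemma form3_contraction:
  assumes "form3 p D" "lnorm_contraction p s r m n T" "x \<in> Rfun {1..m}" "y \<in> Rfun {1..m}" "z \<in> Rfun {1..m}"
  shows "lnorm r {1..n} (\<lambda>k. D (T x k, T y k, T z k) powr (1 / p))
    \<le> lnorm s {1..m} (\<lambda>j. D (x j, y j, z j) powr (1 / p))"
  using assms by (auto simp: form3_def contraction3_def)

text \<open>For this map from l^1 on two coordinates to l^p on one, the contraction property is the
  triangle inequality of \<open>D powr (1 / p)\<close>. The exponent 1 is admissible because 1 \<le>
  p.\<close>

lemma lnorm_contraction_plus: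
  assumes "1 \<le> p"
  shows "lnorm_contraction p 1 (ereal p) 2 1 (\<lambda>x. \<lambda>k\<in>{1..1}. x 1 + x 2)"
  unfolding lnorm_contraction_def
  using assms by (auto simp: lnorm_ereal one_ereal_def powr_powr numeral_2_eq_2 intro!: ext)

lemma form3_triangle:
  assumes "form3 p D"
  shows "D (v + w) powr (1 / p) \<le> D v powr (1 / p) + D w powr (1 / p)"
proof -
  note f = form3D[OF assms]
  obtain v1 v2 v3 w1 w2 w3 where vw: "v = (v1, v2, v3)" "w = (w1, w2, w3)" by (metis prod_cases3)
  define pair :: "real \<Rightarrow> real \<Rightarrow> nat \<Rightarrow> real" where "pair a b = (\<lambda>j\<in>{1..2}. if j = 1 then a else b)" for a b
  have "pair a b \<in> Rfun {1..2}" for a b by (simp add: pair_def)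
  from form3_contraction[OF assms lnorm_contraction_plus this this this, of v1 w1 v2 w2 v3 w3] f(1)
  show ?thesis using f by (simp add: lnorm_ereal one_ereal_def powr_powr numeral_2_eq_2 pair_def vw)
qed

lemma form3_scale:
  assumes "form3 p D" shows "D (c *\<^sub>R w) powr (1 / p) = \<bar>c\<bar> * D w powr (1 / p)"
  using form3D[OF assms] by (simp add: powr_mult powr_powr)

lemma form3_minus:
  assumes "form3 p D" shows "D (- w) = D w"
  using form3D(3)[OF assms, of "-1" w] by simp

lemma form3_root_diff:
  assumes "form3 p D" shows "\<bar>D v powr (1 / p) - D w powr (1 / p)\<bar> \<le> D (v - w) powr (1 / p)"
  using form3_triangle[OF assms, of "v - w" w] form3_triangle[OF assms, of "w - v" v]
    form3_minus[OF assms, of "v - w"] by simp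

text \<open>Constants have seminorm 0, so by the triangle inequality adding one changes
  nothing.\<close>

lemma form3_shift:
  assumes "form3 p D" shows "D (x + c, y + c, z + c) = D (x, y, z)"
proof -
  note f = form3D[OF assms]
  have "\<bar>D (x + c, y + c, z + c) powr (1 / p) - D (x, y, z) powr (1 / p)\<bar> \<le> 0"
    using form3_root_diff[OF assms, of "(x + c, y + c, z + c)" "(x, y, z)"] f(4)[of c] f(1) by simp
  then have "(D (x + c, y + c, z + c) powr (1 / p)) powr p = (D (x, y, z) powr (1 / p)) powr p" by simp
  then show ?thesis using f by (simp add: powr_powr)
qed

text \<open>Shift the third value to 0 and split along the two remaining unit vectors.\<close>

lemma form3_root_le:
  assumes "form3 p D"
  shows "D (x, y, z) powr (1 / p) \<le> \<bar>x - z\<bar> * D (1, 0, 0) powr (1 / p) + \<bar>y - z\<bar> * D (0, 1, 0) powr (1 / p)"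
proof -
  have "D (x, y, z) = D (x - z, y - z, 0)" using form3_shift[OF assms, of "x - z" z "y - z" 0] by simp
  also have "\<dots> powr (1 / p) \<le> D ((x - z) *\<^sub>R (1, 0, 0)) powr (1 / p) + D ((y - z) *\<^sub>R (0, 1, 0)) powr (1 / p)"
    using form3_triangle[OF assms, of "(x - z) *\<^sub>R (1, 0, 0)" "(y - z) *\<^sub>R (0, 1, 0)"] by simp
  finally show ?thesis by (simp only: form3_scale[OF assms])
qed

lemma symmetric3_unit:
  assumes "symmetric3 D" shows "D (0, 1, 0) = D (1, 0, 0)" "D (0, 0, 1) = D (1, 0, 0)"
  using assms by (metis symmetric3_def)+

lemma symmetric3_perm:
  fixes x y z :: real
  assumes "symmetric3 D"
  shows "D (x, z, y) = D (x, y, z)" "D (y, x, z) = D (x, y, z)" "D (z, y, x) = D (x, y, z)"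
    "D (y, z, x) = D (x, y, z)" "D (z, x, y) = D (x, y, z)"
  using assms by (metis symmetric3_def)+

lemma symmetric3_root_le:
  assumes "form3 p D" "symmetric3 D"
  shows "D (x, y, z) powr (1 / p) \<le> D (1, 0, 0) powr (1 / p) * (\<bar>x - z\<bar> + \<bar>y - z\<bar>)"
  using form3_root_le[OF assms(1)] symmetric3_unit[OF assms(2)] by (simp add: algebra_simps)

text \<open>Subtract from \<open>w = (x, y, z)\<close> its reflection \<open>(z, y, x)\<close> to get \<open>(x - z) (1, 0, -1)\<close>;
  then \<open>(1, 0, -1) + (1, -1, 0)\<close> is \<open>3 (1, 0, 0)\<close> up to a constant.\<close>

lemma symmetric3_root_ge:
  assumes "form3 p D" "symmetric3 D"
  shows "\<bar>x - z\<bar> * D (1, 0, 0) powr (1 / p) \<le> 2 * D (x, y, z) powr (1 / p)"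
    and "\<bar>x - y\<bar> * D (1, 0, 0) powr (1 / p) \<le> 2 * D (x, y, z) powr (1 / p)"
    and "\<bar>y - z\<bar> * D (1, 0, 0) powr (1 / p) \<le> 2 * D (x, y, z) powr (1 / p)"
proof -
  have *: "\<bar>x - z\<bar> * D (1, 0, 0) powr (1 / p) \<le> 2 * D (x, y, z) powr (1 / p)" for x y z
  proof -
    let ?N = "\<lambda>w. D w powr (1 / p)"
    have "?N ((x - z) *\<^sub>R (1, 0, -1)) \<le> ?N (x, y, z) + ?N (- (z, y, x))"
      using form3_triangle[OF assms(1), of "(x, y, z)" "- (z, y, x)"] by simp
    also have "\<dots> = 2 * ?N (x, y, z)"
      by (simp only: form3_minus[OF assms(1)] symmetric3_perm(3)[OF assms(2), of x y z])
    finally have a: "\<bar>x - z\<bar> * ?N (1, 0, -1) \<le> 2 * ?N (x, y, z)"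
      by (simp only: form3_scale[OF assms(1)])
    have "3 * ?N (1, 0, 0) = ?N (3 *\<^sub>R (1, 0, 0))" by (simp only: form3_scale[OF assms(1)])
    also have "\<dots> = ?N (2, -1, -1)" using form3_shift[OF assms(1), of 2 1 "-1" "-1"] by simp
    also have "\<dots> \<le> ?N (1, 0, -1) + ?N (1, -1, 0)"
      using form3_triangle[OF assms(1), of "(1, 0, -1)" "(1, -1, 0)"] by simp
    also have "\<dots> = 2 * ?N (1, 0, -1)"
      using symmetric3_perm(1)[OF assms(2), of 1 0 "-1"] by simp
    finally have "?N (1, 0, 0) \<le> ?N (1, 0, -1)" using powr_ge_zero[of "D (1, 0, 0)" "1 / p"] by linarith
    then have "\<bar>x - z\<bar> * ?N (1, 0, 0) \<le> \<bar>x - z\<bar> * ?N (1, 0, -1)" by (intro mult_left_mono) auto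
    with a show ?thesis by linarith
  qed
  from *[of x z y] show "\<bar>x - z\<bar> * D (1, 0, 0) powr (1 / p) \<le> 2 * D (x, y, z) powr (1 / p)" .
  from *[of x y z] symmetric3_perm(1)[OF assms(2), of x y z] show "\<bar>x - y\<bar> * D (1, 0, 0) powr (1 / p) \<le> 2 * D (x, y, z) powr (1 / p)"
    by simp
  from *[of y z x] symmetric3_perm(2)[OF assms(2), of x y z] show "\<bar>y - z\<bar> * D (1, 0, 0) powr (1 / p) \<le> 2 * D (x, y, z) powr (1 / p)"
    by simp
qed

subsection \<open>Closure properties of the contraction property\<close>

lemma lnorm_contractionD:
  assumes "lnorm_contraction p s r m n T"
  shows "0 < s" "s \<le> ereal p" "ereal p \<le> r" "finite {1..m}" "{1..m} \<noteq> {}" "finite {1..n}" "{1..n} \<noteq> {}"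
    "T \<in> Rfun {1..m} \<rightarrow> Rfun {1..n}"
  using assms by (auto simp: lnorm_contraction_def)

lemma contraction3I:
  assumes "\<And>s r m n T x y z. \<lbrakk>lnorm_contraction p s r m n T; x \<in> Rfun {1..m}; y \<in> Rfun {1..m}; z \<in> Rfun {1..m}\<rbrakk>
    \<Longrightarrow> lnorm r {1..n} (\<lambda>k. D (T x k, T y k, T z k) powr (1 / p))
       \<le> lnorm s {1..m} (\<lambda>j. D (x j, y j, z j) powr (1 / p))"
  shows "contraction3 p D"
  using assms by (auto simp: contraction3_def)

lemma form3_add:
  assumes "form3 p D" "form3 p D'" shows "form3 p (\<lambda>w. D w + D' w)"
proof -
  note f = form3D[OF assms(1)] and f' = form3D[OF assms(2)]
  have "contraction3 p (\<lambda>w. D w + D' w)"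
  proof (rule contraction3I)
    fix s r m n T x y z
    assume T: "lnorm_contraction p s r m n T" and u: "x \<in> Rfun {1..m}" "y \<in> Rfun {1..m}" "z \<in> Rfun {1..m}"
    show "lnorm r {1..n} (\<lambda>k. (D (T x k, T y k, T z k) + D' (T x k, T y k, T z k)) powr (1 / p))
       \<le> lnorm s {1..m} (\<lambda>j. (D (x j, y j, z j) + D' (x j, y j, z j)) powr (1 / p))"
      using f f' lnorm_contractionD[OF T] form3_contraction[OF assms(1) T u] form3_contraction[OF assms(2) T u]
      by (intro lnorm_contraction_add) auto
  qed
  then show ?thesis unfolding form3_def by (simp only: f f') (simp add: algebra_simps f f')
qed

lemma form3_cmult:
  assumes "form3 p D" "0 \<le> c" shows "form3 p (\<lambda>w. c * D w)"
proof -
  note f = form3D[OF assms(1)]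
  have "contraction3 p (\<lambda>w. c * D w)"
  proof (rule contraction3I)
    fix s r m n T x y z
    assume T: "lnorm_contraction p s r m n T" and u: "x \<in> Rfun {1..m}" "y \<in> Rfun {1..m}" "z \<in> Rfun {1..m}"
    note t = lnorm_contractionD[OF T]
    have "0 < r" using t by (meson less_le_trans)
    show "lnorm r {1..n} (\<lambda>k. (c * D (T x k, T y k, T z k)) powr (1 / p))
       \<le> lnorm s {1..m} (\<lambda>j. (c * D (x j, y j, z j)) powr (1 / p))"
      using f t \<open>0 < r\<close> form3_contraction[OF assms(1) T u] \<open>0 \<le> c\<close>
      by (simp add: powr_mult lnorm_scale mult_left_mono)
  qed
  then show ?thesis unfolding form3_def using \<open>0 \<le> c\<close> by (simp only: f) (simp add: f)
qed

lemma form3_sum: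
  assumes "finite K" "K \<noteq> {}" "\<And>k. k \<in> K \<Longrightarrow> form3 p (D k)" shows "form3 p (\<lambda>w. \<Sum>k\<in>K. D k w)"
  using assms by (induction K rule: finite_ne_induct) (auto intro: form3_add)

text \<open>Every condition in \<open>form3\<close> is an equation or weak inequality between
  continuous expressions in finitely many values of the form. The filter is arbitrary because the
  limits come both from sequences and from a cluster point in a product space.\<close>

lemma form3_tendsto:
  fixes X :: "'i \<Rightarrow> real \<times> real \<times> real \<Rightarrow> real"
  assumes "F \<noteq> bot" and ev: "eventually (\<lambda>i. form3 p (X i)) F" and lim: "\<And>w. ((\<lambda>i. X i w) \<longlongrightarrow> D w) F"
  shows "form3 p D"
  unfolding form3_def
proof (intro conjI allI)
  obtain i where "form3 p (X i)" using eventually_happens'[OF \<open>F \<noteq> bot\<close> ev] by blast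
  then show "1 < p" by (rule form3D)
  show "0 \<le> D w" for w
    by (rule tendsto_lowerbound[OF lim _ \<open>F \<noteq> bot\<close>]) (rule eventually_mono[OF ev], erule form3D)
  show "D (c *\<^sub>R w) = \<bar>c\<bar> powr p * D w" for c w
  proof (rule tendsto_unique[OF \<open>F \<noteq> bot\<close> lim])
    have "((\<lambda>i. \<bar>c\<bar> powr p * X i w) \<longlongrightarrow> \<bar>c\<bar> powr p * D w) F" by (intro tendsto_intros lim)
    then show "((\<lambda>i. X i (c *\<^sub>R w)) \<longlongrightarrow> \<bar>c\<bar> powr p * D w) F"
      by (rule Lim_transform_eventually) (rule eventually_mono[OF ev], simp add: form3D(3))
  qed
  show "D (c, c, c) = 0" for c
  proof (rule tendsto_unique[OF \<open>F \<noteq> bot\<close> lim])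
    show "((\<lambda>i. X i (c, c, c)) \<longlongrightarrow> 0) F"
      by (rule Lim_transform_eventually[OF tendsto_const[of 0]]) (rule eventually_mono[OF ev], simp add: form3D(4))
  qed
  show "contraction3 p D"
  proof (rule contraction3I)
    fix s r m n T x y z
    assume T: "lnorm_contraction p s r m n T" and u: "x \<in> Rfun {1..m}" "y \<in> Rfun {1..m}" "z \<in> Rfun {1..m}"
    note t = lnorm_contractionD[OF T]
    have "0 < r" using t by (meson less_le_trans)
    have nn: "eventually (\<lambda>i. 0 \<le> X i w) F" for w by (rule eventually_mono[OF ev]) (erule form3D)
    have root: "((\<lambda>i. X i w powr (1 / p)) \<longlongrightarrow> D w powr (1 / p)) F" for w
      using \<open>1 < p\<close> nn by (intro tendsto_powr' lim tendsto_const) auto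
    show "lnorm r {1..n} (\<lambda>k. D (T x k, T y k, T z k) powr (1 / p))
       \<le> lnorm s {1..m} (\<lambda>j. D (x j, y j, z j) powr (1 / p))"
    proof (rule tendsto_le[OF \<open>F \<noteq> bot\<close>])
      show "((\<lambda>i. lnorm r {1..n} (\<lambda>k. X i (T x k, T y k, T z k) powr (1 / p)))
         \<longlongrightarrow> lnorm r {1..n} (\<lambda>k. D (T x k, T y k, T z k) powr (1 / p))) F"
        by (rule tendsto_lnorm[OF t(6,7) \<open>0 < r\<close> root])
      show "((\<lambda>i. lnorm s {1..m} (\<lambda>j. X i (x j, y j, z j) powr (1 / p)))
         \<longlongrightarrow> lnorm s {1..m} (\<lambda>j. D (x j, y j, z j) powr (1 / p))) F"
        by (rule tendsto_lnorm[OF t(4,5,1) root])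
      show "eventually (\<lambda>i. lnorm r {1..n} (\<lambda>k. X i (T x k, T y k, T z k) powr (1 / p))
         \<le> lnorm s {1..m} (\<lambda>j. X i (x j, y j, z j) powr (1 / p))) F"
        by (rule eventually_mono[OF ev]) (rule form3_contraction[OF _ T u])
    qed
  qed
qed

lemma lnorm_abs: "lnorm s I (\<lambda>k. \<bar>x k\<bar>) = lnorm s I x"
  by (simp add: lnorm_def)

text \<open>For the energy of a single edge, the contraction property is the Lipschitz assumption on
  \<open>T\<close> at the two value vectors at its endpoints.\<close>

lemma form3_diff:
  assumes "1 < p" shows "form3 p (\<lambda>(x, y, z). \<bar>x - y\<bar> powr p)" "form3 p (\<lambda>(x, y, z). \<bar>y - z\<bar> powr p)"
    "form3 p (\<lambda>(x, y, z). \<bar>x - z\<bar> powr p)"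
  unfolding form3_def contraction3_def lnorm_contraction_def using assms
  by (auto simp: powr_powr abs_mult right_diff_distrib[symmetric] powr_mult lnorm_abs)

lemma form3_symmetric_exists:
  assumes "1 < p" shows "\<exists>D. form3 p D \<and> symmetric3 D \<and> D (1, 0, 0) = 1"
proof -
  let ?D = "\<lambda>w. (\<lambda>(x, y, z). \<bar>x - y\<bar> powr p) w + (\<lambda>(x, y, z). \<bar>y - z\<bar> powr p) w + (\<lambda>(x, y, z). \<bar>x - z\<bar> powr p) w"
  \<comment> \<open>Two of the three edges meet at a vertex, so the unscaled sum has value 2 at
    \<open>(1, 0, 0)\<close>.\<close>
  have "form3 p (\<lambda>w. 1/2 * ?D w)"
    by (intro form3_cmult form3_add form3_diff assms) auto
  moreover have "symmetric3 (\<lambda>w. 1/2 * ?D w)" by (auto simp: symmetric3_def abs_minus_commute)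
  ultimately show ?thesis by (intro exI[of _ "\<lambda>w. 1/2 * ?D w"]) auto
qed

section \<open>The trace of the glued energy\<close>

text \<open>Energy on \<open>V\<^sub>1\<close>; \<open>a\<close>, \<open>b\<close>, \<open>c\<close> are the values at the midpoints opposite to \<open>q\<^sub>1\<close>, \<open>q\<^sub>2\<close>, \<open>q\<^sub>3\<close>.\<close>

definition glue3 ::
  "(real \<times> real \<times> real \<Rightarrow> real) \<Rightarrow> real \<times> real \<times> real \<Rightarrow> real \<times> real \<times> real \<Rightarrow> real" where
  "glue3 D = (\<lambda>(x, y, z) (a, b, c). D (x, c, b) + D (c, y, a) + D (b, a, z))"

definition renorm3 :: "(real \<times> real \<times> real \<Rightarrow> real) \<Rightarrow> real \<times> real \<times> real \<Rightarrow> real" where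
  "renorm3 D w = (INF v. glue3 D w v)"

lemma glue3_nonneg:
  assumes "form3 p D" shows "0 \<le> glue3 D w v"
  using form3D(2)[OF assms] by (auto simp: glue3_def split: prod.split)

lemma bdd_below_glue3: "form3 p D \<Longrightarrow> bdd_below (range (glue3 D w))"
  by (rule bdd_belowI2[of _ 0]) (rule glue3_nonneg)

lemma renorm3_le:
  assumes "form3 p D" shows "renorm3 D w \<le> glue3 D w v"
  unfolding renorm3_def by (rule cINF_lower[OF bdd_below_glue3[OF assms]]) simp

lemma renorm3_greatest: "(\<And>v. c \<le> glue3 D w v) \<Longrightarrow> c \<le> renorm3 D w"
  unfolding renorm3_def by (rule cINF_greatest) auto

lemma renorm3_approx:
  assumes "form3 p D" "0 < e" obtains v where "glue3 D w v < renorm3 D w + e"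
  using cInf_lessD[of "range (glue3 D w)" "renorm3 D w + e"] assms(2) by (auto simp: renorm3_def)

lemma renorm3_mono:
  assumes "form3 p D" "\<And>w. D w \<le> D' w" shows "renorm3 D w \<le> renorm3 D' w"
proof (rule renorm3_greatest)
  fix v
  have "renorm3 D w \<le> glue3 D w v" by (rule renorm3_le[OF assms(1)])
  also have "\<dots> \<le> glue3 D' w v" using assms(2) by (auto simp: glue3_def add_mono split: prod.split)
  finally show "renorm3 D w \<le> glue3 D' w v" .
qed

lemma glue3_cmult: "glue3 (\<lambda>w. c * D w) w v = c * glue3 D w v"
  by (auto simp: glue3_def algebra_simps split: prod.split)

lemma glue3_scaleR:
  assumes "form3 p D" shows "glue3 D (c *\<^sub>R w) (c *\<^sub>R v) = \<bar>c\<bar> powr p * glue3 D w v"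
proof -
  have "D (c * x, c * y, c * z) = \<bar>c\<bar> powr p * D (x, y, z)" for x y z
    using form3D(3)[OF assms, of c "(x, y, z)"] by simp
  then show ?thesis by (auto simp: glue3_def algebra_simps split: prod.split)
qed

lemma glue3_contraction:
  assumes "form3 p D" and T: "lnorm_contraction p s r m n T"
    and u: "x \<in> Rfun {1..m}" "y \<in> Rfun {1..m}" "z \<in> Rfun {1..m}"
    and v: "a \<in> Rfun {1..m}" "b \<in> Rfun {1..m}" "c \<in> Rfun {1..m}"
  shows "lnorm r {1..n} (\<lambda>k. glue3 D (T x k, T y k, T z k) (T a k, T b k, T c k) powr (1 / p))
    \<le> lnorm s {1..m} (\<lambda>j. glue3 D (x j, y j, z j) (a j, b j, c j) powr (1 / p))"
  unfolding glue3_def prod.case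
  by (intro lnorm_contraction_add form3_contraction[OF assms(1) T] u v lnorm_contractionD[OF T] add_nonneg_nonneg
      form3D(2)[OF assms(1)]) (use form3D(1)[OF assms(1)] in simp_all)

text \<open>Choose midpoint values for each function that are optimal up to \<open>e\<close>.
  Applying \<open>T\<close> to them gives competitors for the functions transformed by
  \<open>T\<close>, so the contraction property of the glued energy bounds the left side; then let
  \<open>e\<close> tend to 0. No minimiser has to exist.\<close>

lemma contraction3_renorm3:
  assumes D: "form3 p D" shows "contraction3 p (renorm3 D)"
proof (rule contraction3I)
  fix s r m n T x y z
  assume T: "lnorm_contraction p s r m n T" and u: "x \<in> Rfun {1..m}" "y \<in> Rfun {1..m}" "z \<in> Rfun {1..m}"
  note t = lnorm_contractionD[OF T] and f = form3D[OF D]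
  have "0 < r" using t by (meson less_le_trans)
  have nonneg: "0 \<le> renorm3 D w" for w by (rule renorm3_greatest) (rule glue3_nonneg[OF D])
  let ?L = "lnorm r {1..n} (\<lambda>k. renorm3 D (T x k, T y k, T z k) powr (1 / p))"
  have *: "?L \<le> lnorm s {1..m} (\<lambda>j. (renorm3 D (x j, y j, z j) + e) powr (1 / p))" if "0 < e" for e
  proof -
    have "\<exists>v. glue3 D (x j, y j, z j) v < renorm3 D (x j, y j, z j) + e" for j
      using renorm3_approx[OF D \<open>0 < e\<close>] by blast
    then obtain v where v: "\<And>j. glue3 D (x j, y j, z j) (v j) < renorm3 D (x j, y j, z j) + e" by metis
    define a b c where "a = (\<lambda>j\<in>{1..m}. fst (v j))" and "b = (\<lambda>j\<in>{1..m}. fst (snd (v j)))"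
      and "c = (\<lambda>j\<in>{1..m}. snd (snd (v j)))"
    have abc: "a \<in> Rfun {1..m}" "b \<in> Rfun {1..m}" "c \<in> Rfun {1..m}" by (simp_all add: a_def b_def c_def)
    have "?L \<le> lnorm r {1..n} (\<lambda>k. glue3 D (T x k, T y k, T z k) (T a k, T b k, T c k) powr (1 / p))"
      using f nonneg by (intro lnorm_mono t \<open>0 < r\<close>) (auto intro!: powr_mono2 renorm3_le[OF D])
    also have "\<dots> \<le> lnorm s {1..m} (\<lambda>j. glue3 D (x j, y j, z j) (a j, b j, c j) powr (1 / p))"
      by (rule glue3_contraction[OF D T u abc])
    also have "\<dots> \<le> lnorm s {1..m} (\<lambda>j. (renorm3 D (x j, y j, z j) + e) powr (1 / p))"
      using f less_imp_le[OF v]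
      by (intro lnorm_mono t) (auto intro!: powr_mono2 glue3_nonneg[OF D] simp: a_def b_def c_def)
    finally show ?thesis .
  qed
  show "?L \<le> lnorm s {1..m} (\<lambda>j. renorm3 D (x j, y j, z j) powr (1 / p))"
  proof (rule tendsto_lowerbound)
    have "((\<lambda>e. (renorm3 D w + e) powr (1 / p)) \<longlongrightarrow> renorm3 D w powr (1 / p)) (at_right 0)" for w
    proof (rule tendsto_powr')
      show "((\<lambda>e. renorm3 D w + e) \<longlongrightarrow> renorm3 D w) (at_right 0)" by (auto intro!: tendsto_eq_intros)
      have "\<forall>\<^sub>F e::real in at_right 0. 0 < e" by (simp add: eventually_at_filter)
      then show "renorm3 D w \<noteq> 0 \<or> 0 < 1 / p \<and> (\<forall>\<^sub>F e in at_right 0. 0 \<le> renorm3 D w + e)"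
        using f(1) nonneg[of w] by (auto elim!: eventually_mono)
    qed simp
    then show "((\<lambda>e. lnorm s {1..m} (\<lambda>j. (renorm3 D (x j, y j, z j) + e) powr (1 / p)))
        \<longlongrightarrow> lnorm s {1..m} (\<lambda>j. renorm3 D (x j, y j, z j) powr (1 / p))) (at_right 0)"
      by (intro tendsto_lnorm t)
    show "\<forall>\<^sub>F e in at_right 0. ?L \<le> lnorm s {1..m} (\<lambda>j. (renorm3 D (x j, y j, z j) + e) powr (1 / p))"
      using * by (simp add: eventually_at_filter)
  qed simp
qed

text \<open>Scaled competitors give one inequality; the factor \<open>1 / c\<close> later gives the
  reverse one.\<close>

lemma renorm3_scaleR_le:
  assumes D: "form3 p D" shows "renorm3 D (c *\<^sub>R w) \<le> \<bar>c\<bar> powr p * renorm3 D w"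
proof (cases "c = 0")
  case True
  have "renorm3 D (c *\<^sub>R w) \<le> glue3 D (c *\<^sub>R w) (c *\<^sub>R 0)" by (rule renorm3_le[OF D])
  also have "\<dots> = 0" unfolding glue3_scaleR[OF D] using True by simp
  finally show ?thesis using True by simp
next
  case False
  have "renorm3 D (c *\<^sub>R w) / \<bar>c\<bar> powr p \<le> renorm3 D w"
  proof (rule renorm3_greatest)
    fix v
    have "renorm3 D (c *\<^sub>R w) \<le> glue3 D (c *\<^sub>R w) (c *\<^sub>R v)" by (rule renorm3_le[OF D])
    then show "renorm3 D (c *\<^sub>R w) / \<bar>c\<bar> powr p \<le> glue3 D w v"
      using False by (simp add: glue3_scaleR[OF D] field_simps)
  qed
  then show ?thesis using False by (simp add: field_simps)
qed

lemma form3_renorm3: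
  assumes D: "form3 p D" shows "form3 p (renorm3 D)"
  unfolding form3_def
proof (intro conjI allI)
  note f = form3D[OF D]
  show "1 < p" by (rule f)
  show nonneg: "0 \<le> renorm3 D w" for w by (rule renorm3_greatest) (rule glue3_nonneg[OF D])
  show "contraction3 p (renorm3 D)" by (rule contraction3_renorm3[OF D])
  show "renorm3 D (c *\<^sub>R w) = \<bar>c\<bar> powr p * renorm3 D w" for c w
  proof (cases "c = 0")
    case True
    then show ?thesis using renorm3_scaleR_le[OF D, of c w] nonneg[of "c *\<^sub>R w"] by simp
  next
    case False
    then have "renorm3 D w \<le> \<bar>1 / c\<bar> powr p * renorm3 D (c *\<^sub>R w)"
      using renorm3_scaleR_le[OF D, of "1 / c" "c *\<^sub>R w"] by simp
    then have "\<bar>c\<bar> powr p * renorm3 D w \<le> renorm3 D (c *\<^sub>R w)"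
      using False by (simp add: powr_divide field_simps)
    then show ?thesis using renorm3_scaleR_le[OF D, of c w] by simp
  qed
  show "renorm3 D (c, c, c) = 0" for c
    using renorm3_le[OF D, of "(c, c, c)" "(c, c, c)"] nonneg[of "(c, c, c)"] f(4)[of c] by (simp add: glue3_def)
qed

lemma symmetric3_renorm3:
  assumes D: "form3 p D" and "symmetric3 D" shows "symmetric3 (renorm3 D)"
proof -
  note perm = symmetric3_perm[OF assms(2)]
  have swap: "renorm3 D (y, x, z) \<le> renorm3 D (x, y, z)" "renorm3 D (x, z, y) \<le> renorm3 D (x, y, z)" for x y z
  proof -
    show "renorm3 D (y, x, z) \<le> renorm3 D (x, y, z)"
    proof (rule renorm3_greatest)
      fix v :: "real \<times> real \<times> real"
      obtain a b c where v: "v = (a, b, c)" by (metis prod_cases3)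
      \<comment> \<open>Exchanging the first two vertices exchanges the midpoints opposite to them
        and the first two cells; the third midpoint stays.\<close>
      have "glue3 D (y, x, z) (b, a, c) = glue3 D (x, y, z) v"
        using perm[of y c a] perm[of c x b] perm[of a b z] by (simp add: glue3_def v)
      then show "renorm3 D (y, x, z) \<le> glue3 D (x, y, z) v" using renorm3_le[OF D] by metis
    qed
    show "renorm3 D (x, z, y) \<le> renorm3 D (x, y, z)"
    proof (rule renorm3_greatest)
      fix v :: "real \<times> real \<times> real"
      obtain a b c where v: "v = (a, b, c)" by (metis prod_cases3)
      have "glue3 D (x, z, y) (a, c, b) = glue3 D (x, y, z) v"
        using perm[of x b c] perm[of b z a] perm[of c a y] by (simp add: glue3_def v)
      then show "renorm3 D (x, z, y) \<le> glue3 D (x, y, z) v" using renorm3_le[OF D] by metis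
    qed
  qed
  show ?thesis unfolding symmetric3_def by (meson swap antisym)
qed

subsection \<open>The largest subeigenvalue\<close>

lemma le_powr_of_root_le:
  fixes a t p :: real
  assumes "0 < p" "0 \<le> a" "a powr (1 / p) \<le> t" shows "a \<le> t powr p"
proof -
  have "(a powr (1 / p)) powr p \<le> t powr p" using assms by (intro powr_mono2) auto
  then show ?thesis using assms by (simp add: powr_powr)
qed

lemma symmetric3_le:
  assumes "form3 p D" "symmetric3 D"
  shows "D (x, y, z) \<le> D (1, 0, 0) * (\<bar>x - z\<bar> + \<bar>y - z\<bar>) powr p"
proof -
  note f = form3D[OF assms(1)]
  have "D (x, y, z) \<le> (D (1, 0, 0) powr (1 / p) * (\<bar>x - z\<bar> + \<bar>y - z\<bar>)) powr p"
    by (rule le_powr_of_root_le) (use f symmetric3_root_le[OF assms] in auto)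
  then show ?thesis using f by (simp add: powr_mult powr_powr)
qed

text \<open>The upper bound for \<open>A\<close> involves two edges, and each costs a factor 2 in
  the lower bound for \<open>D\<close>; this is the 4.\<close>

lemma symmetric3_compare:
  assumes A: "form3 p A" "symmetric3 A" and D: "form3 p D" "symmetric3 D"
  shows "A w * D (1, 0, 0) \<le> 4 powr p * A (1, 0, 0) * D w"
proof -
  note f = form3D[OF A(1)] and g = form3D[OF D(1)]
  obtain x y z where w: "w = (x, y, z)" by (metis prod_cases3)
  let ?r = "\<lambda>t. t powr (1 / p)"
  have "?r (A w) * ?r (D (1, 0, 0)) \<le> ?r (A (1, 0, 0)) * (\<bar>x - z\<bar> + \<bar>y - z\<bar>) * ?r (D (1, 0, 0))"
    using symmetric3_root_le[OF A, of x y z] by (intro mult_right_mono) (auto simp: w)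
  also have "\<dots> = ?r (A (1, 0, 0)) * (\<bar>x - z\<bar> * ?r (D (1, 0, 0)) + \<bar>y - z\<bar> * ?r (D (1, 0, 0)))"
    by (simp add: algebra_simps)
  also have "\<dots> \<le> ?r (A (1, 0, 0)) * (2 * ?r (D w) + 2 * ?r (D w))"
    unfolding w by (intro mult_left_mono add_mono symmetric3_root_ge D) auto
  finally have "?r (A w * D (1, 0, 0)) \<le> 4 * ?r (A (1, 0, 0)) * ?r (D w)"
    using f g by (simp add: powr_mult)
  then have "A w * D (1, 0, 0) \<le> (4 * ?r (A (1, 0, 0)) * ?r (D w)) powr p"
    using f g by (intro le_powr_of_root_le) auto
  then show ?thesis using f g by (simp add: powr_mult powr_powr)
qed

text \<open>The root of the glued energy dominates that of each cell, which in turn controls the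
  edges of that cell. This gives positivity of the eigenvalue and, later, bounds for
  near-minimisers.\<close>

lemma glue3_bounds:
  fixes x y z a b c :: real
  assumes D: "form3 p D" "symmetric3 D" "1 \<le> D (1, 0, 0)"
  defines "G \<equiv> glue3 D (x, y, z) (a, b, c) powr (1 / p)"
  shows "\<bar>x - b\<bar> \<le> 2 * G" "\<bar>x - c\<bar> \<le> 2 * G" "\<bar>y - a\<bar> \<le> 2 * G" "\<bar>b - z\<bar> \<le> 2 * G" "\<bar>a - z\<bar> \<le> 2 * G"
proof -
  note f = form3D[OF D(1)]
  let ?r = "\<lambda>t. t powr (1 / p)"
  have one: "1 \<le> ?r (D (1, 0, 0))" using D(3) f(1) by (simp add: ge_one_powr_ge_zero)
  have cells: "?r (D (x, c, b)) \<le> G" "?r (D (c, y, a)) \<le> G" "?r (D (b, a, z)) \<le> G"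
    unfolding G_def glue3_def using f(1,2) by (auto intro!: powr_mono2)
  have edge: "\<bar>s\<bar> \<le> 2 * G" if "\<bar>s\<bar> * ?r (D (1, 0, 0)) \<le> 2 * ?r (D w)" "?r (D w) \<le> G" for s w
    using that mult_left_mono[OF one abs_ge_zero[of s]] by linarith
  show "\<bar>x - b\<bar> \<le> 2 * G" by (rule edge[OF symmetric3_root_ge(1)[OF D(1,2)] cells(1)])
  show "\<bar>x - c\<bar> \<le> 2 * G" by (rule edge[OF symmetric3_root_ge(2)[OF D(1,2)] cells(1)])
  show "\<bar>y - a\<bar> \<le> 2 * G" by (rule edge[OF symmetric3_root_ge(3)[OF D(1,2)] cells(2)])
  show "\<bar>b - z\<bar> \<le> 2 * G" by (rule edge[OF symmetric3_root_ge(1)[OF D(1,2)] cells(3)])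
  show "\<bar>a - z\<bar> \<le> 2 * G" by (rule edge[OF symmetric3_root_ge(3)[OF D(1,2)] cells(3)])
qed

text \<open>The inequality says \<open>l * D w \<le> renorm3 D w\<close>, but without the infimum,
  so that for fixed \<open>w\<close> and \<open>v\<close> it passes to pointwise limits. The
  normalisation makes the admissible forms uniformly bounded at each \<open>w\<close>.\<close>

definition subeigenvalue3 :: "real \<Rightarrow> real \<Rightarrow> bool" where
  "subeigenvalue3 p l \<longleftrightarrow> (\<exists>D. form3 p D \<and> symmetric3 D \<and> D (1, 0, 0) = 1 \<and> (\<forall>w v. l * D w \<le> glue3 D w v))"

text \<open>With all midpoint values 0, only the cell at the first vertex carries energy, and it
  carries \<open>D (1, 0, 0)\<close>.\<close>

lemma subeigenvalue3_le_1:
  assumes "subeigenvalue3 p l" shows "l \<le> 1"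
proof -
  obtain D where D: "form3 p D" "D (1, 0, 0) = 1" and "l * D (1, 0, 0) \<le> glue3 D (1, 0, 0) (0, 0, 0)"
    using assms unfolding subeigenvalue3_def by blast
  then show ?thesis using form3D(4)[OF D(1), of 0] by (simp add: glue3_def)
qed

lemma subeigenvalue3_pos:
  assumes "1 < p" shows "subeigenvalue3 p (1 / 8 powr p)"
proof -
  obtain D where D: "form3 p D" "symmetric3 D" "D (1, 0, 0) = 1"
    using form3_symmetric_exists[OF assms] by blast
  have "D w \<le> 8 powr p * glue3 D w v" for w v
  proof -
    obtain x y z a b c where w: "w = (x, y, z)" and v: "v = (a, b, c)" by (metis prod_cases3)
    let ?G = "glue3 D w v powr (1 / p)"
    have "D w powr (1 / p) \<le> \<bar>x - z\<bar> + \<bar>y - z\<bar>"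
      using symmetric3_root_le[OF D(1,2), of x y z] D(3) by (simp add: w)
    \<comment> \<open>Go from x to z through b and from y to z through a: four edges, each at most
      \<open>2 * ?G\<close>.\<close>
    also have "\<dots> \<le> 8 * ?G"
      using glue3_bounds(1,3-5)[OF D(1,2), where x = x and y = y and z = z and a = a and b = b and c = c] D(3)
      unfolding w v by linarith
    finally have "D w \<le> (8 * ?G) powr p"
      using assms form3D[OF D(1)] by (intro le_powr_of_root_le) auto
    then show ?thesis using assms glue3_nonneg[OF D(1), of w v] by (simp add: powr_mult powr_powr)
  qed
  then show ?thesis unfolding subeigenvalue3_def using D
    by (intro exI[of _ D]) (auto simp: field_simps)
qed

lemma tendsto_glue3:
  assumes "\<And>w. ((\<lambda>i. X i w) \<longlongrightarrow> D w) F" shows "((\<lambda>i. glue3 (X i) w v) \<longlongrightarrow> glue3 D w v) F"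
proof -
  obtain x y z a b c where "w = (x, y, z)" "v = (a, b, c)" by (metis prod_cases3)
  then show ?thesis using assms by (auto simp: glue3_def intro!: tendsto_add)
qed

lemma symmetric3_tendsto:
  fixes X :: "'i \<Rightarrow> real \<times> real \<times> real \<Rightarrow> real"
  assumes "F \<noteq> bot" and ev: "eventually (\<lambda>i. symmetric3 (X i)) F" and lim: "\<And>w. ((\<lambda>i. X i w) \<longlongrightarrow> D w) F"
  shows "symmetric3 D"
  unfolding symmetric3_def
proof (intro allI conjI)
  fix x y z
  show "D (y, x, z) = D (x, y, z)"
    by (rule tendsto_unique[OF \<open>F \<noteq> bot\<close> lim], rule Lim_transform_eventually[OF lim[of "(x, y, z)"]])
      (rule eventually_mono[OF ev], simp add: symmetric3_def)
  show "D (x, z, y) = D (x, y, z)"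
    by (rule tendsto_unique[OF \<open>F \<noteq> bot\<close> lim], rule Lim_transform_eventually[OF lim[of "(x, y, z)"]])
      (rule eventually_mono[OF ev], simp add: symmetric3_def)
qed

lemma compact_Pi_UNIV:
  fixes B :: "'i \<Rightarrow> 'b::topological_space set"
  assumes "\<And>i. compact (B i)" shows "compact (PiE UNIV B)"
  using compactin_PiE[of "\<lambda>_. euclidean" UNIV B] assms by (simp add: euclidean_product_topology)

text \<open>Pointwise bounds put the normalised forms into a compact box of the product topology, and every
  defining condition involves finitely many values of the form only.\<close>

lemma subeigenvalue3_Sup:
  assumes "1 < p" shows "subeigenvalue3 p (Sup {l. subeigenvalue3 p l})" (is "subeigenvalue3 p ?L")
proof -
  have bdd: "bdd_above {l. subeigenvalue3 p l}" by (rule bdd_aboveI[of _ 1]) (auto dest: subeigenvalue3_le_1)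
  have "\<exists>l. subeigenvalue3 p l \<and> ?L - 1 / real (Suc n) < l" for n
    using less_cSup_iff[OF _ bdd, of "?L - 1 / real (Suc n)"] subeigenvalue3_pos[OF assms] by auto
  then obtain l where l: "\<And>n. subeigenvalue3 p (l n)" "\<And>n. ?L - 1 / real (Suc n) < l n" by metis
  obtain D where D: "\<And>n. form3 p (D n)" "\<And>n. symmetric3 (D n)" "\<And>n. D n (1, 0, 0) = 1"
      "\<And>n w v. l n * D n w \<le> glue3 (D n) w v"
    using l(1) unfolding subeigenvalue3_def by metis
  define C where "C = PiE UNIV (\<lambda>(x, y, z::real). {0 .. (\<bar>x - z\<bar> + \<bar>y - z\<bar>) powr p})"
  have "compact C" unfolding C_def by (rule compact_Pi_UNIV) auto
  moreover have "D n \<in> C" for n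
    using form3D(2)[OF D(1)] symmetric3_le[OF D(1,2), of n] D(3) by (auto simp: C_def)
  \<comment> \<open>The product has uncountably many factors, so compactness yields a cluster point
    but not necessarily a convergent subsequence; limits are taken along the filter \<open>G\<close>
    instead.\<close>
  ultimately obtain E where ne: "inf (nhds E) (filtermap D sequentially) \<noteq> bot"
    unfolding compact_filter by (metis (no_types, lifting) always_eventually eventually_filtermap filtermap_bot_iff sequentially_bot)
  define G where "G = inf (nhds E) (filtermap D sequentially)"
  have ev: "eventually P G" if "eventually (\<lambda>n. P (D n)) sequentially" for P
    unfolding G_def using that by (metis eventually_filtermap filter_leD inf_le2)
  have lim: "((\<lambda>X. X w) \<longlongrightarrow> E w) G" for w
  proof -
    have "((\<lambda>X. X w) \<longlongrightarrow> E w) (nhds E)"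
    proof (rule topological_tendstoI)
      fix S :: "real set" assume "open S" "E w \<in> S"
      then have "open ((\<lambda>X. X w) -` S)" by (intro open_vimage continuous_on_product_coordinates)
      then show "eventually (\<lambda>X. X w \<in> S) (nhds E)"
        unfolding eventually_nhds using \<open>E w \<in> S\<close> by (intro exI[of _ "(\<lambda>X. X w) -` S"]) auto
    qed
    then show ?thesis by (rule tendsto_mono[rotated]) (simp add: G_def)
  qed
  have "G \<noteq> bot" using ne by (simp add: G_def)
  have "form3 p E" by (rule form3_tendsto[OF \<open>G \<noteq> bot\<close> ev lim]) (simp add: D)
  moreover have "symmetric3 E" by (rule symmetric3_tendsto[OF \<open>G \<noteq> bot\<close> ev lim]) (simp add: D)
  moreover have "E (1, 0, 0) = 1"
    by (rule tendsto_unique[OF \<open>G \<noteq> bot\<close> lim], rule Lim_transform_eventually[OF tendsto_const[of 1]])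
      (rule ev, simp add: D)
  moreover have "?L * E w \<le> glue3 E w v" for w v
  proof (cases "E w = 0")
    case True
    then show ?thesis using glue3_nonneg[OF \<open>form3 p E\<close>] by simp
  next
    case False
    then have "0 < E w" using form3D(2)[OF \<open>form3 p E\<close>, of w] by simp
    \<comment> \<open>Only a \<open>t\<close> strictly below \<open>?L\<close> is eventually below
      \<open>l n\<close>; \<open>dense_le\<close> recovers \<open>?L\<close> itself.\<close>
    have "t \<le> glue3 E w v / E w" if "t < ?L" for t
    proof -
      obtain N where N: "1 / real (Suc N) < ?L - t" using \<open>t < ?L\<close> by (metis diff_gt_0_iff_gt nat_approx_posE)
      have "t * D n w \<le> glue3 (D n) w v" if "N \<le> n" for n
      proof -
        have "1 / real (Suc n) \<le> 1 / real (Suc N)" using that by (intro divide_left_mono) auto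
        then have "t \<le> l n" using N l(2)[of n] by linarith
        then have "t * D n w \<le> l n * D n w" using form3D(2)[OF D(1)] by (intro mult_right_mono) auto
        also have "\<dots> \<le> glue3 (D n) w v" by (rule D)
        finally show ?thesis .
      qed
      then have e: "eventually (\<lambda>X. t * X w \<le> glue3 X w v) G"
        by (intro ev) (auto simp: eventually_sequentially)
      have "t * E w \<le> glue3 E w v"
        by (rule tendsto_le[OF \<open>G \<noteq> bot\<close> tendsto_glue3[OF lim] tendsto_mult[OF tendsto_const lim] e])
      then show ?thesis using \<open>0 < E w\<close> by (simp add: field_simps)
    qed
    then have "?L \<le> glue3 E w v / E w" by (rule dense_le)
    then show ?thesis using \<open>0 < E w\<close> by (simp add: field_simps)
  qed
  ultimately show ?thesis unfolding subeigenvalue3_def by blast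
qed

subsection \<open>Existence of an eigenform\<close>

lemma glue3_sum: "glue3 (\<lambda>w. \<Sum>k\<in>K. c k * D k w) w v = (\<Sum>k\<in>K. c k * glue3 (D k) w v)"
proof -
  obtain x y z a b c where "w = (x, y, z)" "v = (a, b, c)" by (metis prod_cases3)
  then show ?thesis by (simp add: glue3_def algebra_simps sum.distrib)
qed

lemma subeigenvalue3I:
  assumes "form3 p D" "symmetric3 D" "0 < D (1, 0, 0)" "\<And>w v. l * D w \<le> glue3 D w v"
  shows "subeigenvalue3 p l"
proof -
  let ?c = "1 / D (1, 0, 0)"
  have "form3 p (\<lambda>w. ?c * D w)" using assms by (intro form3_cmult) auto
  moreover have "symmetric3 (\<lambda>w. ?c * D w)" using assms(2) by (simp add: symmetric3_def)
  moreover have "l * (?c * D w) \<le> glue3 (\<lambda>w. ?c * D w) w v" for w v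
    unfolding glue3_cmult using mult_left_mono[OF assms(4)[of w v], of ?c] assms(3) by (simp add: algebra_simps)
  ultimately show ?thesis unfolding subeigenvalue3_def using assms(3)
    by (intro exI[of _ "\<lambda>w. ?c * D w"]) simp
qed

text \<open>The bound \<open>M\<close> makes the p-th roots of all \<open>E n\<close> Lipschitz with
  a common constant, so the argument may move along with the form.\<close>

lemma tendsto_form3_diag:
  assumes E: "\<And>n. form3 p (E n)" "\<And>n. symmetric3 (E n)" "\<And>n. E n (1, 0, 0) \<le> M"
    and lim: "\<And>w. (\<lambda>n. E n w) \<longlonglongrightarrow> D w" and w: "u \<longlonglongrightarrow> w"
  shows "(\<lambda>n. E n (u n)) \<longlonglongrightarrow> D w"
proof -
  note f = form3D[OF E(1)]
  let ?r = "\<lambda>t. t powr (1 / p)"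
  obtain x y z where xyz: "w = (x, y, z)" by (metis prod_cases3)
  define d where "d n = \<bar>fst (u n - w) - snd (snd (u n - w))\<bar> + \<bar>fst (snd (u n - w)) - snd (snd (u n - w))\<bar>" for n
  have "(\<lambda>n. u n - w) \<longlonglongrightarrow> 0" using w by (simp add: LIM_zero)
  then have "d \<longlonglongrightarrow> \<bar>fst (0::real\<times>real\<times>real) - snd (snd (0::real\<times>real\<times>real))\<bar>
      + \<bar>fst (snd (0::real\<times>real\<times>real)) - snd (snd (0::real\<times>real\<times>real))\<bar>"
    unfolding d_def by (intro tendsto_intros)
  then have d: "(\<lambda>n. ?r M * d n) \<longlonglongrightarrow> 0" by (intro tendsto_mult_right_zero) simp
  have diff: "norm (?r (E n (u n)) - ?r (E n w)) \<le> ?r M * d n" for n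
  proof -
    have "\<bar>?r (E n (u n)) - ?r (E n w)\<bar> \<le> ?r (E n (u n - w))" by (rule form3_root_diff[OF E(1)])
    also have "\<dots> \<le> ?r (E n (1, 0, 0)) * d n"
      using symmetric3_root_le[OF E(1,2), of n "fst (u n - w)" "fst (snd (u n - w))" "snd (snd (u n - w))"]
      by (simp only: d_def prod.collapse)
    also have "\<dots> \<le> ?r M * d n" using f E(3) by (intro mult_right_mono powr_mono2) (auto simp: d_def)
    finally show ?thesis by simp
  qed
  have "(\<lambda>n. ?r (E n (u n)) - ?r (E n w)) \<longlonglongrightarrow> 0"
    by (rule Lim_null_comparison[OF always_eventually d]) (use diff in blast)
  moreover have "(\<lambda>n. ?r (E n w)) \<longlonglongrightarrow> ?r (D w)"
    using f by (intro tendsto_powr' lim) auto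
  ultimately have "(\<lambda>n. ?r (E n (u n))) \<longlonglongrightarrow> ?r (D w)"
    using tendsto_add by fastforce
  then have "(\<lambda>n. ?r (E n (u n)) powr p) \<longlonglongrightarrow> ?r (D w) powr p"
    by (rule tendsto_powr'[OF _ tendsto_const]) (use f in auto)
  moreover have "0 \<le> D w" by (rule LIMSEQ_le_const[OF lim]) (use f in auto)
  ultimately show ?thesis using f by (simp add: powr_powr)
qed

text \<open>\<open>A\<close> is a subeigenform for the largest possible \<open>L\<close>. If the increasing iterates \<open>T\<^sup>n A\<close> doubled
  \<open>A\<close>, the sum of \<open>t\<^sup>k T\<^sup>k A\<close> over \<open>k < n\<close> with \<open>t\<^sup>n = 1/2\<close> would be a subeigenform for \<open>L / t\<close>.\<close>

lemma eigenform3_exists: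
  assumes "1 < p"
  obtains L E where "0 < L" "form3 p E" "symmetric3 E" "1 \<le> E (1, 0, 0)" "\<And>w. renorm3 E w = L * E w"
proof -
  define L where "L = Sup {l. subeigenvalue3 p l}"
  have le_L: "l \<le> L" if "subeigenvalue3 p l" for l
    unfolding L_def using that subeigenvalue3_le_1 by (auto intro!: cSup_upper bdd_aboveI[of _ 1])
  have "0 < L" using le_L[OF subeigenvalue3_pos[OF assms]] by (rule less_le_trans[rotated]) simp
  obtain A where A: "form3 p A" "symmetric3 A" "A (1, 0, 0) = 1" "\<And>w v. L * A w \<le> glue3 A w v"
    using subeigenvalue3_Sup[OF assms] unfolding L_def subeigenvalue3_def by blast
  define T where "T D = (\<lambda>w. 1 / L * renorm3 D w)" for D
  define E where "E n = (T ^^ n) A" for n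
  have E0: "E 0 = A" and ES: "E (Suc n) = T (E n)" for n by (simp_all add: E_def)
  have E: "form3 p (E n) \<and> symmetric3 (E n)" for n
  proof (induction n)
    case (Suc n)
    then have "form3 p (T (E n))" unfolding T_def using \<open>0 < L\<close> by (intro form3_cmult form3_renorm3) auto
    moreover have "symmetric3 (T (E n))"
      using symmetric3_renorm3[of p "E n"] Suc by (simp add: T_def symmetric3_def)
    ultimately show ?case by (simp add: ES)
  qed (simp add: E0 A)
  then have Ef: "form3 p (E n)" and Es: "symmetric3 (E n)" for n by auto
  note f = form3D[OF Ef]
  have step: "L * E (Suc n) w \<le> glue3 (E n) w v" for n w v
    using renorm3_le[OF Ef, of n w v] \<open>0 < L\<close> by (simp add: ES T_def)
  have inc: "E n w \<le> E (Suc n) w" for n w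
  proof (induction n arbitrary: w)
    \<comment> \<open>The subeigenform inequality for \<open>A\<close> starts the growth;
      monotonicity of \<open>renorm3\<close> propagates it.\<close>
    case 0
    have "L * A w \<le> renorm3 A w" by (rule renorm3_greatest) (rule A)
    then show ?case using \<open>0 < L\<close> by (simp add: ES E0 T_def field_simps)
  next
    case (Suc n)
    have "renorm3 (E n) w \<le> renorm3 (E (Suc n)) w" by (rule renorm3_mono[OF Ef Suc])
    then show ?case using \<open>0 < L\<close> unfolding ES[of "Suc n"] ES[of n] T_def by (simp add: divide_right_mono)
  qed
  then have mono: "m \<le> n \<Longrightarrow> E m w \<le> E n w" for m n w
    using lift_Suc_mono_le[of "\<lambda>n. E n w"] by blast
  have no_doubling: "\<exists>w. E n w < 2 * A w" for n
  proof (rule ccontr)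
    assume "\<not> ?thesis"
    then have dbl: "2 * A w \<le> E n w" for w by (meson not_less)
    have "n \<noteq> 0" using dbl[of "(1, 0, 0)"] A(3) E0 by (cases n) auto
    define t :: real where "t = (1 / 2) powr (1 / real n)"
    have "0 < t" by (simp add: t_def)
    have tn: "t ^ n = 1 / 2" using \<open>n \<noteq> 0\<close> by (simp add: t_def powr_realpow[symmetric] powr_powr)
    then have "t < 1" using \<open>0 < t\<close> one_le_power[of t n] by linarith
    define B where "B w = (\<Sum>k<n. t ^ k * E k w)" for w
    have "form3 p B"
      unfolding B_def using \<open>n \<noteq> 0\<close> \<open>0 < t\<close> by (intro form3_sum form3_cmult Ef) auto
    moreover have "symmetric3 B" using Es by (simp add: B_def symmetric3_def)
    moreover have "0 < B (1, 0, 0)"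
      unfolding B_def
      by (rule sum_pos2[of _ 0]) (use \<open>n \<noteq> 0\<close> \<open>0 < t\<close> A(3) f in \<open>auto simp: E0\<close>)
    moreover have "L / t * B w \<le> glue3 B w v" for w v
    proof -
      \<comment> \<open>The added bracket is nonnegative because \<open>t ^ n = 1 / 2\<close> and
        \<open>E n\<close> is assumed to double \<open>A\<close>. With it the sum runs over k = 1,
        ..., n, and an index shift extracts a factor t.\<close>
      have "B w \<le> B w + (t ^ n * E n w - A w)" using dbl[of w] by (simp add: tn)
      also have "\<dots> = (\<Sum>k<Suc n. t ^ k * E k w) - A w" by (simp add: B_def)
      also have "\<dots> = t * (\<Sum>k<n. t ^ k * E (Suc k) w)"
        by (simp add: sum.lessThan_Suc_shift E0 sum_distrib_left mult.assoc del: sum.lessThan_Suc)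
      finally have "L / t * B w \<le> L * (\<Sum>k<n. t ^ k * E (Suc k) w)"
        using \<open>0 < t\<close> \<open>0 < L\<close> by (simp add: field_simps)
      also have "\<dots> = (\<Sum>k<n. t ^ k * (L * E (Suc k) w))" by (simp add: sum_distrib_left mult_ac)
      also have "\<dots> \<le> (\<Sum>k<n. t ^ k * glue3 (E k) w v)"
        using \<open>0 < t\<close> by (intro sum_mono mult_left_mono step) auto
      also have "\<dots> = glue3 B w v" by (simp add: B_def[abs_def] glue3_sum)
      finally show ?thesis .
    qed
    ultimately have "L / t \<le> L" by (intro le_L subeigenvalue3I)
    then show False using \<open>0 < t\<close> \<open>t < 1\<close> \<open>0 < L\<close> by (simp add: field_simps)
  qed
  \<comment> \<open>By \<open>symmetric3_compare\<close> with \<open>A (1, 0, 0) = 1\<close>, a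
    value of at least \<open>M\<close> at \<open>(1, 0, 0)\<close> would force \<open>E n\<close> to
    double \<open>A\<close> everywhere.\<close>
  define M where "M = 2 * 4 powr p"
  have bound: "E n (1, 0, 0) \<le> M" for n
  proof (rule ccontr)
    assume "\<not> ?thesis"
    then have M: "M \<le> E n (1, 0, 0)" by simp
    have "2 * A w \<le> E n w" for w
    proof -
      have "A w * M \<le> A w * E n (1, 0, 0)" using M form3D[OF A(1)] by (intro mult_left_mono) auto
      also have "\<dots> \<le> 4 powr p * E n w" using symmetric3_compare[OF A(1,2) Ef Es, of w n] A(3) by simp
      finally show ?thesis by (simp add: M_def)
    qed
    then show False using no_doubling[of n] by (meson not_less)
  qed
  have "\<exists>l. (\<lambda>n. E n w) \<longlonglongrightarrow> l" for w
  proof -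
    obtain x y z where w: "w = (x, y, z)" by (metis prod_cases3)
    have "E n w \<le> M * (\<bar>x - z\<bar> + \<bar>y - z\<bar>) powr p" for n
      using symmetric3_le[OF Ef Es, of n x y z] mult_right_mono[OF bound[of n], of "(\<bar>x - z\<bar> + \<bar>y - z\<bar>) powr p"]
      by (simp add: w)
    then show ?thesis using incseq_convergent[of "\<lambda>n. E n w"] inc by (metis incseq_SucI)
  qed
  then obtain D where lim: "\<And>w. (\<lambda>n. E n w) \<longlonglongrightarrow> D w" by metis
  have le_D: "E n w \<le> D w" for n w
    by (rule LIMSEQ_le_const[OF lim]) (use mono in blast)
  have D: "form3 p D" "symmetric3 D"
    using form3_tendsto[OF sequentially_bot _ lim, of p] symmetric3_tendsto[OF sequentially_bot _ lim] Ef Es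
    by auto
  have one: "1 \<le> E n (1, 0, 0)" for n using mono[of 0 n "(1, 0, 0)"] A(3) by (simp add: E0)
  have "renorm3 D w = L * D w" for w
  proof (rule antisym)
    show "L * D w \<le> renorm3 D w"
    proof (rule renorm3_greatest)
      fix v
      show "L * D w \<le> glue3 D w v"
        by (rule LIMSEQ_le[OF tendsto_mult[OF tendsto_const LIMSEQ_Suc[OF lim]] tendsto_glue3[OF lim]])
          (use step in blast)
    qed
    obtain x y z where w: "w = (x, y, z)" by (metis prod_cases3)
    \<comment> \<open>Near-minimisers for \<open>E n\<close> are to converge along a subsequence to
      a competitor for \<open>D\<close> with energy at most \<open>L * D w\<close>.\<close>
    have "\<exists>v. glue3 (E n) w v < L * D w + 1 / real (Suc n)" for n
    proof -
      obtain v where "glue3 (E n) w v < renorm3 (E n) w + 1 / real (Suc n)"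
        by (rule renorm3_approx[OF Ef, where e = "1 / real (Suc n)"]) auto
      moreover have "renorm3 (E n) w = L * E (Suc n) w" using \<open>0 < L\<close> by (simp add: ES T_def)
      moreover have "L * E (Suc n) w \<le> L * D w" using le_D \<open>0 < L\<close> by (intro mult_left_mono) auto
      ultimately show ?thesis by (intro exI[of _ v]) simp
    qed
    then obtain v where v: "\<And>n. glue3 (E n) w (v n) < L * D w + 1 / real (Suc n)" by metis
    \<comment> \<open>The errors \<open>1 / real (Suc n)\<close> are at most 1, so
      \<open>glue3_bounds\<close> keeps all midpoint values within \<open>G\<close> of x or
      y.\<close>
    define G where "G = 2 * (L * D w + 1) powr (1 / p)"
    have "v n \<in> {y - G..y + G} \<times> {x - G..x + G} \<times> {x - G..x + G}" for n
    proof -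
      obtain a b c where abc: "v n = (a, b, c)" by (metis prod_cases3)
      have "1 / real (Suc n) \<le> 1" by simp
      then have "glue3 (E n) w (v n) \<le> L * D w + 1" using v[of n] by linarith
      then have "2 * glue3 (E n) w (v n) powr (1 / p) \<le> G"
        unfolding G_def using f glue3_nonneg[OF Ef] by (intro mult_left_mono powr_mono2) auto
      then have "\<bar>y - a\<bar> \<le> G" "\<bar>x - b\<bar> \<le> G" "\<bar>x - c\<bar> \<le> G"
        using glue3_bounds(1-3)[OF Ef Es one, where x = x and y = y and z = z and a = a and b = b and c = c]
        unfolding w abc by (meson order_trans)+
      then show ?thesis unfolding abc by auto
    qed
    moreover have "compact ({y - G..y + G} \<times> {x - G..x + G} \<times> {x - G..x + G})"
      by (intro compact_Times compact_Icc)
    ultimately obtain v' \<sigma> where \<sigma>: "strict_mono \<sigma>" and v': "(v \<circ> \<sigma>) \<longlonglongrightarrow> v'"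
      unfolding compact_def by metis
    obtain a b c where abc: "v' = (a, b, c)" by (metis prod_cases3)
    define al be ga where "al n = fst (v (\<sigma> n))" and "be n = fst (snd (v (\<sigma> n)))"
      and "ga n = snd (snd (v (\<sigma> n)))" for n
    have sub: "(\<lambda>n. E (\<sigma> n) w) \<longlonglongrightarrow> D w" for w
      using LIMSEQ_subseq_LIMSEQ[OF lim \<sigma>] by (simp add: o_def)
    have "al \<longlonglongrightarrow> a" "be \<longlonglongrightarrow> b" "ga \<longlonglongrightarrow> c"
      unfolding al_def be_def ga_def using v'
      by (auto simp: abc o_def dest: tendsto_fst tendsto_snd intro: tendsto_eq_intros)
    then have "(\<lambda>n. E (\<sigma> n) (x, ga n, be n) + E (\<sigma> n) (ga n, y, al n) + E (\<sigma> n) (be n, al n, z))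
       \<longlonglongrightarrow> D (x, c, b) + D (c, y, a) + D (b, a, z)"
      by (intro tendsto_add tendsto_form3_diag[OF Ef Es bound sub] tendsto_Pair tendsto_const)
    then have "(\<lambda>n. glue3 (E (\<sigma> n)) w (v (\<sigma> n))) \<longlonglongrightarrow> glue3 D w v'"
      by (simp add: glue3_def w abc al_def be_def ga_def case_prod_beta)
    moreover have "(\<lambda>n. L * D w + 1 / real (Suc (\<sigma> n))) \<longlonglongrightarrow> L * D w + 0"
      using LIMSEQ_subseq_LIMSEQ[OF LIMSEQ_inverse_real_of_nat \<sigma>]
      by (intro tendsto_add tendsto_const) (simp add: o_def inverse_eq_divide)
    ultimately have "glue3 D w v' \<le> L * D w + 0"
      by (rule LIMSEQ_le) (use v less_imp_le in blast)
    then show "renorm3 D w \<le> L * D w" using renorm3_le[OF D(1), of w v'] by simp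
  qed
  moreover have "1 \<le> D (1, 0, 0)" using one[of 0] le_D[of 0 "(1, 0, 0)"] by linarith
  ultimately show ?thesis using that \<open>0 < L\<close> D by blast
qed

subsection \<open>Uniqueness of the eigenvalue\<close>

definition nondegenerate3 :: "(real \<times> real \<times> real \<Rightarrow> real) \<Rightarrow> bool" where
  "nondegenerate3 D \<longleftrightarrow> (\<forall>x y z. D (x, y, z) = 0 \<longrightarrow> x = y \<and> y = z)"

lemma nondegenerate3_pos:
  assumes "form3 p D" "nondegenerate3 D" shows "0 < D (1, 0, 0)"
proof -
  have "D (1, 0, 0) \<noteq> 0" using assms(2) unfolding nondegenerate3_def by (metis zero_neq_one)
  then show ?thesis using form3D(2)[OF assms(1), of "(1, 0, 0)"] by simp
qed

lemma symmetric3_nondegenerate: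
  assumes D: "form3 p D" "symmetric3 D" "0 < D (1, 0, 0)" shows "nondegenerate3 D"
  unfolding nondegenerate3_def
proof (intro allI impI)
  fix x y z assume "D (x, y, z) = 0"
  then have "D (x, y, z) powr (1 / p) = 0" by simp
  then have "\<bar>x - y\<bar> * D (1, 0, 0) powr (1 / p) \<le> 0" "\<bar>y - z\<bar> * D (1, 0, 0) powr (1 / p) \<le> 0"
    using symmetric3_root_ge(2,3)[OF D(1,2), where x = x and y = y and z = z] by simp_all
  then show "x = y \<and> y = z" using D(3) by (auto simp: mult_le_0_iff)
qed

text \<open>Modulo constants the p-th roots are seminorms on the plane, and that of
  \<open>D2\<close> is a norm. Its minimum on the unit circle is positive by compactness, whereas
  the seminorm of \<open>D1\<close> is at most a multiple of the Euclidean norm.\<close>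

lemma form3_compare:
  assumes D1: "form3 p D1" and D2: "form3 p D2" "nondegenerate3 D2"
  obtains C where "0 < C" "\<And>w. D1 w \<le> C * D2 w"
proof -
  note f1 = form3D[OF D1] and f2 = form3D[OF D2(1)]
  define N1 N2 :: "real \<times> real \<Rightarrow> real"
    where "N1 v = D1 (fst v, snd v, 0) powr (1 / p)" and "N2 v = D2 (fst v, snd v, 0) powr (1 / p)" for v
  have upper: "D (x, y, 0) powr (1 / p) \<le> (D (1, 0, 0) powr (1 / p) + D (0, 1, 0) powr (1 / p)) * norm (x, y)"
    if D: "form3 p D" for D x y
  proof -
    have "D (x, y, 0) powr (1 / p) \<le> \<bar>x\<bar> * D (1, 0, 0) powr (1 / p) + \<bar>y\<bar> * D (0, 1, 0) powr (1 / p)"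
      using form3_root_le[OF D, of x y 0] by simp
    also have "\<dots> \<le> norm (x, y) * D (1, 0, 0) powr (1 / p) + norm (x, y) * D (0, 1, 0) powr (1 / p)"
      using norm_fst_le[of x y] norm_snd_le[of y x] by (intro add_mono mult_right_mono) auto
    finally show ?thesis by (simp add: algebra_simps)
  qed
  let ?c1 = "D1 (1, 0, 0) powr (1 / p) + D1 (0, 1, 0) powr (1 / p)"
  let ?c2 = "D2 (1, 0, 0) powr (1 / p) + D2 (0, 1, 0) powr (1 / p)"
  have "?c2-lipschitz_on (sphere 0 1) N2"
  proof (rule lipschitz_onI)
    fix v w
    have "\<bar>N2 v - N2 w\<bar> \<le> D2 (fst v - fst w, snd v - snd w, 0) powr (1 / p)"
      using form3_root_diff[OF D2(1), of "(fst v, snd v, 0)" "(fst w, snd w, 0)"] by (simp add: N2_def)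
    also have "\<dots> \<le> ?c2 * norm (fst v - fst w, snd v - snd w)" by (rule upper[OF D2(1)])
    finally show "dist (N2 v) (N2 w) \<le> ?c2 * dist v w" by (simp add: dist_norm minus_prod_def)
  qed simp
  then have cont: "continuous_on (sphere 0 1) N2" by (rule lipschitz_on_continuous_on)
  have "(1, 0) \<in> sphere (0 :: real \<times> real) 1" by simp
  then have "\<exists>v0\<in>sphere 0 1. \<forall>v\<in>sphere 0 1. N2 v0 \<le> N2 v"
    by (intro continuous_attains_inf compact_sphere cont) (rule ex_in_conv[THEN iffD1], rule exI)
  then obtain v0 where v0: "v0 \<in> sphere 0 1" "\<And>v. v \<in> sphere 0 1 \<Longrightarrow> N2 v0 \<le> N2 v" by auto
  define m where "m = N2 v0"
  have "N2 v0 \<noteq> 0"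
  proof
    assume "N2 v0 = 0"
    then have "D2 (fst v0, snd v0, 0) = 0" by (simp add: N2_def)
    then have "v0 = 0" using D2(2) unfolding nondegenerate3_def by (metis prod_eqI fst_zero snd_zero)
    then show False using v0(1) by simp
  qed
  then have "0 < m" by (simp add: m_def N2_def less_le)
  have lower: "m * norm v \<le> N2 v" for v
  proof (cases "v = 0")
    case False
    let ?v = "(1 / norm v) *\<^sub>R v"
    have "m \<le> N2 ?v" unfolding m_def using False by (intro v0(2)) simp
    also have "N2 ?v = D2 ((1 / norm v) *\<^sub>R (fst v, snd v, 0)) powr (1 / p)" by (simp add: N2_def)
    also have "\<dots> = N2 v / norm v" unfolding form3_scale[OF D2(1)] by (simp add: N2_def)
    finally show ?thesis using False by (simp add: field_simps)
  qed (simp add: N2_def)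
  define K where "K = ?c1 / m"
  have "0 \<le> K" using \<open>0 < m\<close> by (simp add: K_def)
  have "D1 w \<le> K powr p * D2 w" for w
  proof -
    obtain x y z where w: "w = (x, y, z)" by (metis prod_cases3)
    have s: "D1 w = D1 (x - z, y - z, 0)" "D2 w = D2 (x - z, y - z, 0)"
      using form3_shift[OF D1, of "x - z" z "y - z" 0] form3_shift[OF D2(1), of "x - z" z "y - z" 0]
      by (simp_all add: w)
    have "D1 w powr (1 / p) \<le> ?c1 * norm (x - z, y - z)" unfolding s by (rule upper[OF D1])
    also have "\<dots> = K * (m * norm (x - z, y - z))" using \<open>0 < m\<close> by (simp add: K_def)
    also have "\<dots> \<le> K * N2 (x - z, y - z)" using \<open>0 \<le> K\<close> by (intro mult_left_mono lower)
    also have "\<dots> = K * D2 w powr (1 / p)" by (simp add: N2_def s)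
    finally have "D1 w \<le> (K * D2 w powr (1 / p)) powr p" using f1 by (intro le_powr_of_root_le) auto
    then show ?thesis using f1 f2 \<open>0 \<le> K\<close> by (simp add: powr_mult powr_powr)
  qed
  \<comment> \<open>\<open>K\<close> may be 0, and the constant promised is positive.\<close>
  moreover have "K powr p * D2 w \<le> (K powr p + 1) * D2 w" for w
    using f2 by (intro mult_right_mono) auto
  ultimately have "D1 w \<le> (K powr p + 1) * D2 w" for w by (meson order_trans)
  then show ?thesis using that[of "K powr p + 1"] by (simp add: add_nonneg_pos)
qed

lemma renorm3_le_cmult:
  assumes "form3 p D1" "form3 p D2" "0 < c" "\<And>w. D1 w \<le> c * D2 w" shows "renorm3 D1 w \<le> c * renorm3 D2 w"
proof -
  have "renorm3 D1 w / c \<le> renorm3 D2 w"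
  proof (rule renorm3_greatest)
    fix v
    have "renorm3 D1 w \<le> renorm3 (\<lambda>w. c * D2 w) w" by (rule renorm3_mono[OF assms(1,4)])
    also have "\<dots> \<le> glue3 (\<lambda>w. c * D2 w) w v"
      by (rule renorm3_le[OF form3_cmult]) (use assms in auto)
    finally show "renorm3 D1 w / c \<le> glue3 D2 w v" using \<open>0 < c\<close> by (simp add: glue3_cmult field_simps)
  qed
  then show ?thesis using \<open>0 < c\<close> by (simp add: field_simps)
qed

text \<open>Applying \<open>renorm3\<close> to \<open>D1 \<le> C * D2\<close> and inserting both
  eigenvalue equations improves C by the factor \<open>\<rho>1 / \<rho>2\<close>. If this were below
  1, iteration would give D1 = 0.\<close>

lemma eigenvalue3_le:
  assumes D1: "form3 p D1" "nondegenerate3 D1" "\<And>w. \<rho>1 * renorm3 D1 w = D1 w" "0 < \<rho>1"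
    and D2: "form3 p D2" "nondegenerate3 D2" "\<And>w. \<rho>2 * renorm3 D2 w = D2 w" "0 < \<rho>2"
  shows "\<rho>2 \<le> \<rho>1"
proof (rule ccontr)
  assume "\<not> ?thesis"
  then have "\<rho>1 < \<rho>2" by simp
  define \<theta> where "\<theta> = \<rho>1 / \<rho>2"
  have \<theta>: "0 < \<theta>" "\<theta> < 1" using D1(4) D2(4) \<open>\<rho>1 < \<rho>2\<close> by (simp_all add: \<theta>_def)
  obtain C where C: "0 < C" "\<And>w. D1 w \<le> C * D2 w" by (rule form3_compare[OF D1(1) D2(1,2)]) (rule that)
  have *: "D1 w \<le> C * \<theta> ^ n * D2 w" for n w
  proof (induction n arbitrary: w)
    case (Suc n)
    have "D1 w = \<rho>1 * renorm3 D1 w" by (simp add: D1)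
    also have "\<dots> \<le> \<rho>1 * (C * \<theta> ^ n * renorm3 D2 w)"
      using C \<theta> Suc D1(4) by (intro mult_left_mono renorm3_le_cmult[OF D1(1) D2(1)]) auto
    also have "\<dots> = C * \<theta> ^ Suc n * D2 w"
      using D2(3)[of w, symmetric] D2(4) by (simp add: \<theta>_def)
    finally show ?case .
  qed (use C in simp)
  have "(\<lambda>n. C * \<theta> ^ n * D2 (1, 0, 0)) \<longlonglongrightarrow> C * 0 * D2 (1, 0, 0)"
    by (rule tendsto_mult[OF tendsto_mult[OF tendsto_const LIMSEQ_realpow_zero] tendsto_const]) (use \<theta> in auto)
  then have "D1 (1, 0, 0) \<le> C * 0 * D2 (1, 0, 0)" by (rule LIMSEQ_le_const) (use * in blast)
  then show False using nondegenerate3_pos[OF D1(1,2)] by simp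
qed

subsection \<open>Isometries of the gasket\<close>

lemma dist_sg_map: "dist (sg_map q i x) (sg_map q i y) = dist x y / 2"
proof -
  have "sg_map q i x - sg_map q i y = (1 / 2) *\<^sub>R (x - y)" by (simp add: sg_map_def algebra_simps)
  then show ?thesis by (simp add: dist_norm)
qed

lemma sg_map_fixed [simp]: "sg_map q i (q i) = q i"
  by (simp add: sg_map_def)

lemma sg_map_commute: "sg_map q i (q j) = sg_map q j (q i)"
proof -
  have "sg_map q i (q j) = (1 / 2) *\<^sub>R (q i + q j)" for i j
    by (simp add: sg_map_def vec_eq_iff field_simps)
  then show ?thesis by (simp add: add.commute)
qed

lemma inj_sg_map: "inj (sg_map q i)"
  by (rule injI) (metis dist_eq_0_iff dist_sg_map divide_eq_0_iff zero_neq_numeral)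

section \<open>The gasket as the unique self-similar compact set\<close>

definition sg_union :: "(nat \<Rightarrow> real^2) \<Rightarrow> (real^2) set \<Rightarrow> (real^2) set" where
  "sg_union q X = (\<Union>i\<in>{1,2,3}. sg_map q i ` X)"

lemma sg_union_mono: "X \<subseteq> Y \<Longrightarrow> sg_union q X \<subseteq> sg_union q Y"
  by (auto simp: sg_union_def)

lemma compact_sg_union: "compact X \<Longrightarrow> compact (sg_union q X)"
  unfolding sg_union_def sg_map_def
  by (intro compact_UN compact_continuous_image continuous_intros) auto

text \<open>At a point of \<open>K\<close> farthest from \<open>K'\<close>, self-similarity of both
  sets bounds this largest distance by half of itself, so it is 0. Used in both directions, this
  gives uniqueness.\<close>

lemma sg_fixed_subset:
  assumes K: "compact K" "K = sg_union q K" and K': "K' \<noteq> {}" "compact K'" "K' = sg_union q K'"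
  shows "K \<subseteq> K'"
proof (cases "K = {}")
  case False
  have "closed K'" using K'(2) by (rule compact_imp_closed)
  have "\<exists>x\<in>K. \<forall>y\<in>K. infdist y K' \<le> infdist x K'"
    by (intro continuous_attains_sup K(1) False continuous_on_infdist continuous_on_id)
  then obtain x where x: "x \<in> K" "\<And>y. y \<in> K \<Longrightarrow> infdist y K' \<le> infdist x K'" by blast
  have "x \<in> sg_union q K" using x(1) K(2) by blast
  then obtain i y where i: "i \<in> {1,2,3}" and y: "y \<in> K" "x = sg_map q i y" unfolding sg_union_def by blast
  obtain z where z: "z \<in> K'" "infdist y K' = dist y z"
    using infdist_attains_inf[OF \<open>closed K'\<close> K'(1)] by blast
  have "sg_map q i z \<in> sg_union q K'" using z(1) i unfolding sg_union_def by blast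
  then have "infdist x K' \<le> dist x (sg_map q i z)" using K'(3) by (intro infdist_le) blast
  also have "\<dots> \<le> infdist x K' / 2" using x(2)[OF y(1)] z(2) by (simp add: y(2) dist_sg_map)
  finally have "infdist x K' \<le> 0" by simp
  then have "infdist y K' = 0" if "y \<in> K" for y
    using x(2)[OF that] infdist_nonneg[of y K'] by linarith
  then show ?thesis using in_closed_iff_infdist_zero[OF \<open>closed K'\<close> K'(1)] by blast
qed simp

text \<open>The gasket is the intersection of the decreasing iterates of the full triangle; each
  iterate contains the vertices, as \<open>q i\<close> is fixed by
  \<open>sg_map q i\<close>.\<close>

lemma sg_gasket_exists:
  obtains K where "K \<noteq> {}" "compact K" "K = sg_union q K" "sg_V0 q \<subseteq> K" "K \<subseteq> convex hull sg_V0 q"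
proof -
  define \<Delta> where "\<Delta> = convex hull sg_V0 q"
  define X where "X n = (sg_union q ^^ n) \<Delta>" for n
  have X0: "X 0 = \<Delta>" and XS: "X (Suc n) = sg_union q (X n)" for n by (simp_all add: X_def)
  have qD: "q i \<in> \<Delta>" if "i \<in> {1,2,3}" for i
    unfolding \<Delta>_def by (rule hull_inc) (use that in \<open>auto simp: sg_V0_def\<close>)
  have "sg_map q i x \<in> \<Delta>" if "i \<in> {1,2,3}" "x \<in> \<Delta>" for i x
  proof -
    have "sg_map q i x = (1 - 1/2) *\<^sub>R q i + (1/2) *\<^sub>R x"
      by (simp add: sg_map_def vec_eq_iff field_simps)
    also have "\<dots> \<in> \<Delta>"
      by (rule convexD_alt) (use that qD in \<open>auto simp: \<Delta>_def\<close>)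
    finally show ?thesis .
  qed
  then have "sg_union q \<Delta> \<subseteq> \<Delta>" by (auto simp: sg_union_def)
  then have dec: "X (Suc n) \<subseteq> X n" for n
    by (induction n) (simp_all add: X0 XS sg_union_mono)
  then have anti: "m \<le> n \<Longrightarrow> X n \<subseteq> X m" for m n using lift_Suc_antimono_le[of X] by blast
  define K where "K = (\<Inter>n. X n)"
  have "compact (X n)" for n
    by (induction n) (simp_all add: X0 XS compact_sg_union \<Delta>_def sg_V0_def finite_imp_compact_convex_hull)
  then have "compact K" unfolding K_def by (intro compact_Inter) auto
  have "q i \<in> X n" if "i \<in> {1,2,3}" for i n
  proof (induction n)
    case (Suc n)
    then have "sg_map q i (q i) \<in> sg_union q (X n)" unfolding sg_union_def using that by blast
    then show ?case by (simp add: XS)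
  qed (use qD[OF that] in \<open>simp add: X0\<close>)
  then have V0: "sg_V0 q \<subseteq> K" by (auto simp: sg_V0_def K_def)
  have "K = sg_union q K"
  proof (intro equalityI subsetI)
    fix x assume "x \<in> sg_union q K"
    then have "x \<in> X (Suc n)" for n unfolding XS using sg_union_mono[of K "X n"] by (auto simp: K_def)
    then show "x \<in> K" using dec by (auto simp: K_def)
  next
    fix x assume x: "x \<in> K"
    show "x \<in> sg_union q K"
    proof (rule ccontr)
      assume no: "x \<notin> sg_union q K"
      \<comment> \<open>The cell containing x could depend on the level. Injectivity of
        \<open>sg_map q i\<close> shows that a cell missed by the limit set is already missed at
        some level; at the largest of the three levels all cells are missed.\<close>
      have "\<exists>n. x \<notin> sg_map q i ` X n" if "i \<in> {1,2,3}" for i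
      proof (rule ccontr)
        assume "\<not> ?thesis"
        then have all: "x \<in> sg_map q i ` X n" for n by blast
        then obtain y where y: "x = sg_map q i y" by blast
        then have "y \<in> X n" for n using all[of n] inj_sg_map[of q i] by (metis imageE injD)
        then have "x \<in> sg_union q K" using that y by (auto simp: K_def sg_union_def)
        then show False using no by simp
      qed
      then obtain N where N: "\<And>i. i \<in> {1,2,3} \<Longrightarrow> x \<notin> sg_map q i ` X (N i)" by metis
      define n where "n = max (N 1) (max (N 2) (N 3))"
      have "x \<in> sg_union q (X n)" using x XS[of n] by (auto simp: K_def)
      then obtain i where i: "i \<in> {1,2,3}" "x \<in> sg_map q i ` X n" unfolding sg_union_def by blast
      then have "X n \<subseteq> X (N i)" by (intro anti) (auto simp: n_def)
      then show False using N[OF i(1)] i(2) by blast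
    qed
  qed
  moreover have "K \<subseteq> \<Delta>" using X0 by (auto simp: K_def)
  moreover have "K \<noteq> {}" using V0 by (auto simp: sg_V0_def)
  ultimately show ?thesis using that \<open>compact K\<close> V0 unfolding \<Delta>_def by blast
qed

lemma sg_gasket_between: "sg_V0 q \<subseteq> sg_gasket q" "sg_gasket q \<subseteq> convex hull sg_V0 q"
proof -
  obtain K where K: "K \<noteq> {}" "compact K" "K = sg_union q K" "sg_V0 q \<subseteq> K" "K \<subseteq> convex hull sg_V0 q"
    by (rule sg_gasket_exists)
  have "sg_gasket q = K"
    unfolding sg_gasket_def sg_union_def[symmetric]
  proof (rule the_equality)
    show "K \<noteq> {} \<and> compact K \<and> K = sg_union q K" using K(1-3) by simp
    show "K' = K" if "K' \<noteq> {} \<and> compact K' \<and> K' = sg_union q K'" for K'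
      using sg_fixed_subset[of K q K'] sg_fixed_subset[of K' q K] that K(1-3) by blast
  qed
  then show "sg_V0 q \<subseteq> sg_gasket q" "sg_gasket q \<subseteq> convex hull sg_V0 q" using K by simp_all
qed

text \<open>A segment of maximal length in a simplex joins two vertices, so isometries permute the vertices.\<close>

lemma sg_sym_vertex:
  assumes q: "equilateral q" and g: "g \<in> sg_sym q" and i: "i \<in> {1,2,3}"
  shows "g (q i) \<in> sg_V0 q"
proof (rule ccontr)
  assume no: "g (q i) \<notin> sg_V0 q"
  obtain d where "0 < d" and d: "\<And>i j. \<lbrakk>i \<in> {1,2,3}; j \<in> {1,2,3}; i \<noteq> j\<rbrakk> \<Longrightarrow> dist (q i) (q j) = d"
    using q unfolding equilateral_def by blast
  define S where "S = sg_V0 q"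
  have S: "finite S" "S \<noteq> {}" by (simp_all add: S_def sg_V0_def)
  have "\<exists>j\<in>{1,2,3}. j \<noteq> i" using i by auto
  then obtain j where j: "j \<in> {1,2,3}" "j \<noteq> i" by blast
  have inK: "q k \<in> sg_gasket q" if "k \<in> {1,2,3}" for k
    using sg_gasket_between(1)[of q] that by (auto simp: sg_V0_def)
  then have "g (q k) \<in> sg_gasket q" if "k \<in> {1,2,3}" for k
    using g that by (auto simp: sg_sym_def bij_betw_def)
  then have hull: "g (q k) \<in> convex hull S" if "k \<in> {1,2,3}" for k
    using sg_gasket_between(2)[of q] that by (auto simp: S_def)
  have "dist (g (q i)) (g (q j)) = dist (q i) (q j)" using g inK i j by (simp add: sg_sym_def)
  then have "dist (g (q i)) (g (q j)) = d" using d[of i j] i j by auto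
  \<comment> \<open>In a convex hull, a point outside the generating set can always be replaced by
    one strictly farther from a given point.\<close>
  moreover obtain y where y: "y \<in> convex hull S" "norm (g (q i) - g (q j)) < norm (y - g (q j))"
    using simplex_furthest_lt[OF S(1)] hull[OF i] no unfolding S_def by blast
  moreover obtain u v where uv: "u \<in> S" "v \<in> S" "norm (y - g (q j)) \<le> norm (u - v)"
    using simplex_extremal_le[OF S] y(1) hull[OF j(1)] by blast
  moreover have "dist u v \<le> d"
  proof -
    obtain k l where "k \<in> {1,2,3}" "l \<in> {1,2,3}" "u = q k" "v = q l" using uv by (auto simp: S_def sg_V0_def)
    then show ?thesis using d[of k l] \<open>0 < d\<close> by (cases "k = l") auto
  qed
  ultimately show False by (simp add: dist_norm)
qed

lemma equilateral_distinct:
  assumes "equilateral q" "i \<in> {1,2,3}" "j \<in> {1,2,3}" "i \<noteq> j" shows "q i \<noteq> q j"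
  using assms unfolding equilateral_def by (metis dist_self less_irrefl)

text \<open>The midpoint lies at distance d / 2 from \<open>q i\<close>, whereas vertices lie at
  distance 0 or d.\<close>

lemma equilateral_midpoint_not_vertex:
  assumes q: "equilateral q" and ij: "i \<in> {1,2,3}" "j \<in> {1,2,3}" "i \<noteq> j" and k: "k \<in> {1,2,3}"
  shows "sg_map q i (q j) \<noteq> q k"
proof
  assume eq: "sg_map q i (q j) = q k"
  obtain d where "0 < d" and d: "\<And>i j. \<lbrakk>i \<in> {1,2,3}; j \<in> {1,2,3}; i \<noteq> j\<rbrakk> \<Longrightarrow> dist (q i) (q j) = d"
    using q unfolding equilateral_def by blast
  have "dist (q k) (q i) = d / 2"
    using dist_sg_map[of q i "q j" "q i"] d[of j i] ij eq by auto
  then show False using d[of k i] \<open>0 < d\<close> ij k by (cases "k = i") auto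
qed

subsection \<open>Forms on the vertices of the gasket\<close>

definition vertex_fun :: "(nat \<Rightarrow> real^2) \<Rightarrow> real \<times> real \<times> real \<Rightarrow> real^2 \<Rightarrow> real" where
  "vertex_fun q = (\<lambda>(x, y, z). \<lambda>v\<in>sg_V0 q. if v = q 1 then x else if v = q 2 then y else z)"

definition vertex_values :: "(nat \<Rightarrow> real^2) \<Rightarrow> (real^2 \<Rightarrow> real) \<Rightarrow> real \<times> real \<times> real" where
  "vertex_values q u = (u (q 1), u (q 2), u (q 3))"

context
  fixes q :: "nat \<Rightarrow> real^2"
  assumes q: "equilateral q"
begin

lemma vertex_distinct: "q 1 \<noteq> q 2" "q 1 \<noteq> q 3" "q 2 \<noteq> q 3" "q 2 \<noteq> q 1" "q 3 \<noteq> q 1" "q 3 \<noteq> q 2"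
  using equilateral_distinct[OF q] by (metis insertI1 insertI2 numeral_eq_one_iff numeral_eq_iff semiring_norm(85,86,89) one_eq_numeral_iff)+

lemma vertex_in: "q 1 \<in> sg_V0 q" "q 2 \<in> sg_V0 q" "q 3 \<in> sg_V0 q"
  by (auto simp: sg_V0_def)

lemma vertex_cases: "v \<in> sg_V0 q \<Longrightarrow> v = q 1 \<or> v = q 2 \<or> v = q 3"
  by (auto simp: sg_V0_def)

lemma vertex_fun_apply [simp]:
  "vertex_fun q (x, y, z) (q 1) = x" "vertex_fun q (x, y, z) (q 2) = y" "vertex_fun q (x, y, z) (q 3) = z"
  using vertex_distinct vertex_in by (simp_all add: vertex_fun_def del: One_nat_def)

lemma vertex_fun_in: "vertex_fun q w \<in> Rfun (sg_V0 q)"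
  by (auto simp: vertex_fun_def split: prod.split)

lemma vertex_fun_eqI:
  assumes "f \<in> Rfun (sg_V0 q)" "vertex_values q f = w" shows "f = vertex_fun q w"
proof (rule extensionalityI[OF assms(1) vertex_fun_in])
  fix v assume "v \<in> sg_V0 q"
  then show "f v = vertex_fun q w v"
    using vertex_cases[of v] assms(2)[symmetric] by (auto simp: vertex_values_def simp del: One_nat_def)
qed

lemma vertex_values_fun [simp]: "vertex_values q (vertex_fun q w) = w"
  by (cases w) (simp add: vertex_values_def del: One_nat_def)

lemma restrict_vertex_fun:
  "(\<lambda>v\<in>sg_V0 q. h v) = vertex_fun q (h (q 1), h (q 2), h (q 3))"
  by (rule vertex_fun_eqI) (simp_all add: vertex_values_def vertex_in del: One_nat_def)

lemma vertex_values_restrict: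
  "vertex_values q (\<lambda>v\<in>sg_V0 q. h v) = (h (q 1), h (q 2), h (q 3))"
  by (simp add: restrict_vertex_fun del: One_nat_def)

text \<open>The kernel condition splits in two: constants have energy 0, as \<open>form3\<close>
  asks, and nothing else has, which is \<open>nondegenerate3\<close>.\<close>

lemma resistance_form_imp_form3:
  assumes p: "1 < p" and E: "resistance_form p (sg_V0 q) E"
  defines "D \<equiv> \<lambda>w. E (vertex_fun q w)"
  shows "form3 p D" "nondegenerate3 D" "u \<in> Rfun (sg_V0 q) \<Longrightarrow> E u = D (vertex_values q u)"
proof -
  have nonneg: "0 \<le> E u" if "u \<in> Rfun (sg_V0 q)" for u
    using E that by (simp add: resistance_form_def)
  have hom: "E (\<lambda>x\<in>sg_V0 q. c * u x) powr (1 / p) = \<bar>c\<bar> * E u powr (1 / p)" if "u \<in> Rfun (sg_V0 q)" for c u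
    using E that by (simp add: resistance_form_def seminorm_on_def)
  have ker: "{u \<in> Rfun (sg_V0 q). E u = 0} = range (\<lambda>c::real. \<lambda>x\<in>sg_V0 q. c)"
    using E by (simp add: resistance_form_def)
  show "form3 p D"
    unfolding form3_def
  proof (intro conjI allI)
    show "1 < p" by (rule p)
    show "0 \<le> D w" for w unfolding D_def by (rule nonneg[OF vertex_fun_in])
    show "D (c *\<^sub>R w) = \<bar>c\<bar> powr p * D w" for c w
    proof -
      have "vertex_fun q (c *\<^sub>R w) = (\<lambda>x\<in>sg_V0 q. c * vertex_fun q w x)"
        by (cases w) (simp add: restrict_vertex_fun del: One_nat_def)
      then have "D (c *\<^sub>R w) powr (1 / p) = \<bar>c\<bar> * D w powr (1 / p)"
        using hom[OF vertex_fun_in] by (simp add: D_def)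
      then have "(D (c *\<^sub>R w) powr (1 / p)) powr p = (\<bar>c\<bar> * D w powr (1 / p)) powr p" by simp
      then show ?thesis using p nonneg[OF vertex_fun_in] by (simp add: D_def powr_mult powr_powr)
    qed
    show "D (c, c, c) = 0" for c
    proof -
      have "vertex_fun q (c, c, c) = (\<lambda>x\<in>sg_V0 q. c)" by (simp add: restrict_vertex_fun)
      then have "vertex_fun q (c, c, c) \<in> range (\<lambda>c::real. \<lambda>x\<in>sg_V0 q. c)" by blast
      then show ?thesis using ker by (auto simp: D_def)
    qed
    show "contraction3 p D"
    proof (rule contraction3I)
      fix s r m n T x y z
      assume T: "lnorm_contraction p s r m n T"
        and xyz: "x \<in> Rfun {1..m}" "y \<in> Rfun {1..m}" "z \<in> Rfun {1..m}"
      define u where "u j = vertex_fun q (x j, y j, z j)" for j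
      \<comment> \<open>At each vertex the values of all m functions form the vector to which
        \<open>T\<close> is applied; restriction leaves x, y, z unchanged because they are
        extensional.\<close>
      have col: "(\<lambda>j\<in>{1..m}. u j (q 1)) = x" "(\<lambda>j\<in>{1..m}. u j (q 2)) = y" "(\<lambda>j\<in>{1..m}. u j (q 3)) = z"
        using xyz by (auto simp: u_def extensional_restrict simp del: One_nat_def)
      have gc: "generalized_contraction p (sg_V0 q) E" using E by (simp add: resistance_form_def)
      have "lnorm r {1..n} (\<lambda>k. E (\<lambda>v\<in>sg_V0 q. T (\<lambda>j\<in>{1..m}. u j v) k) powr (1 / p))
          \<le> lnorm s {1..m} (\<lambda>j. E (u j) powr (1 / p))"
        by (rule gc[unfolded generalized_contraction_def, THEN spec[of _ s], THEN spec[of _ r], THEN spec[of _ m],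
              THEN spec[of _ n], THEN spec[of _ T], THEN mp, OF T[unfolded lnorm_contraction_def],
              THEN spec[of _ u], THEN mp]) (simp add: u_def vertex_fun_in)
      then show "lnorm r {1..n} (\<lambda>k. D (T x k, T y k, T z k) powr (1 / p))
          \<le> lnorm s {1..m} (\<lambda>j. D (x j, y j, z j) powr (1 / p))"
        unfolding restrict_vertex_fun col by (simp add: D_def u_def)
    qed
  qed
  show "nondegenerate3 D"
    unfolding nondegenerate3_def
  proof (intro allI impI)
    fix x y z assume "D (x, y, z) = 0"
    then have "vertex_fun q (x, y, z) \<in> {u \<in> Rfun (sg_V0 q). E u = 0}"
      using vertex_fun_in by (simp add: D_def)
    then obtain c where "vertex_fun q (x, y, z) = (\<lambda>v\<in>sg_V0 q. c)"
      unfolding ker by blast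
    then have "vertex_values q (vertex_fun q (x, y, z)) = vertex_values q (vertex_fun q (c, c, c))"
      by (simp add: restrict_vertex_fun)
    then show "x = y \<and> y = z" by simp
  qed
  show "E u = D (vertex_values q u)" if "u \<in> Rfun (sg_V0 q)"
    using vertex_fun_eqI[OF that refl] by (simp add: D_def)
qed

lemma form3_imp_resistance_form:
  assumes D: "form3 p D" "nondegenerate3 D"
  shows "resistance_form p (sg_V0 q) (\<lambda>u. D (vertex_values q u))"
proof -
  note f = form3D[OF D(1)]
  have "seminorm_on (sg_V0 q) (\<lambda>u. D (vertex_values q u) powr (1 / p))"
    unfolding seminorm_on_def
  proof (intro conjI ballI allI)
    fix u c
    show "D (vertex_values q (\<lambda>x\<in>sg_V0 q. c * u x)) powr (1 / p) = \<bar>c\<bar> * D (vertex_values q u) powr (1 / p)"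
      unfolding vertex_values_restrict
      using form3_scale[OF D(1), of c "vertex_values q u"] by (simp add: vertex_values_def)
  next
    fix u v
    show "D (vertex_values q (\<lambda>x\<in>sg_V0 q. u x + v x)) powr (1 / p)
       \<le> D (vertex_values q u) powr (1 / p) + D (vertex_values q v) powr (1 / p)"
      unfolding vertex_values_restrict
      using form3_triangle[OF D(1), of "vertex_values q u" "vertex_values q v"] by (simp add: vertex_values_def)
  qed simp
  moreover have "{u \<in> Rfun (sg_V0 q). D (vertex_values q u) = 0} = range (\<lambda>c::real. \<lambda>x\<in>sg_V0 q. c)"
  proof (intro equalityI subsetI)
    fix u assume "u \<in> {u \<in> Rfun (sg_V0 q). D (vertex_values q u) = 0}"
    then have u: "u \<in> Rfun (sg_V0 q)" and "D (u (q 1), u (q 2), u (q 3)) = 0"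
      by (simp_all add: vertex_values_def)
    then have eq: "u (q 1) = u (q 2)" "u (q 2) = u (q 3)"
      using D(2) unfolding nondegenerate3_def by blast+
    have "u = vertex_fun q (u (q 1), u (q 1), u (q 1))"
      by (rule vertex_fun_eqI[OF u]) (use eq in \<open>simp add: vertex_values_def\<close>)
    then have "u = (\<lambda>x\<in>sg_V0 q. u (q 1))" by (simp only: restrict_vertex_fun)
    then show "u \<in> range (\<lambda>c::real. \<lambda>x\<in>sg_V0 q. c)" by blast
  qed (use f(4) in \<open>auto simp: vertex_values_restrict\<close>)
  moreover have "generalized_contraction p (sg_V0 q) (\<lambda>u. D (vertex_values q u))"
    unfolding generalized_contraction_def
  proof (intro allI impI)
    fix s r m n and T :: "(nat \<Rightarrow> real) \<Rightarrow> nat \<Rightarrow> real" and u :: "nat \<Rightarrow> real^2 \<Rightarrow> real"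
    assume "0 < s \<and> s \<le> ereal p \<and> ereal p \<le> r \<and> 1 \<le> m \<and> 1 \<le> n \<and>
        T \<in> Rfun {1..m} \<rightarrow> Rfun {1..n} \<and>
        T (\<lambda>j\<in>{1..m}. 0) = (\<lambda>k\<in>{1..n}. 0) \<and>
        (\<forall>x\<in>Rfun {1..m}. \<forall>y\<in>Rfun {1..m}.
           lnorm r {1..n} (\<lambda>k. T x k - T y k) \<le> lnorm s {1..m} (\<lambda>j. x j - y j))"
    then have T: "lnorm_contraction p s r m n T" unfolding lnorm_contraction_def .
    let ?c = "\<lambda>v. \<lambda>j\<in>{1..m}. u j v"
    have "lnorm r {1..n} (\<lambda>k. D (T (?c (q 1)) k, T (?c (q 2)) k, T (?c (q 3)) k) powr (1 / p))
        \<le> lnorm s {1..m} (\<lambda>j. D (?c (q 1) j, ?c (q 2) j, ?c (q 3) j) powr (1 / p))"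
      by (rule form3_contraction[OF D(1) T]) auto
    also have "\<dots> = lnorm s {1..m} (\<lambda>j. D (vertex_values q (u j)) powr (1 / p))"
      by (rule lnorm_cong) (simp add: vertex_values_def)
    finally show "lnorm r {1..n} (\<lambda>k. D (vertex_values q (\<lambda>x\<in>sg_V0 q. T (?c x) k)) powr (1 / p))
        \<le> lnorm s {1..m} (\<lambda>j. D (vertex_values q (u j)) powr (1 / p))"
      unfolding vertex_values_restrict .
  qed
  ultimately show ?thesis
    unfolding resistance_form_def using f by (simp add: sg_V0_def)
qed

section \<open>The refined vertex set and the trace back to the three vertices\<close>

definition midpoint_values :: "(real^2 \<Rightarrow> real) \<Rightarrow> real \<times> real \<times> real" where
  "midpoint_values v = (v (sg_map q 2 (q 3)), v (sg_map q 1 (q 3)), v (sg_map q 1 (q 2)))"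

lemma sg_V1_eq:
  "sg_V1 q = {q 1, q 2, q 3, sg_map q 2 (q 3), sg_map q 1 (q 3), sg_map q 1 (q 2)}"
  using sg_map_commute[of q] by (auto simp: sg_V1_def sg_V0_def)

text \<open>Neighbouring cells share a midpoint (\<open>sg_map_commute\<close>); reading the corners
  of cell i as the images of \<open>q 1\<close>, \<open>q 2\<close>, \<open>q 3\<close> in this
  order gives the argument order in \<open>glue3\<close>.\<close>

lemma sg_renorm_eq_glue3:
  assumes "\<And>u. u \<in> Rfun (sg_V0 q) \<Longrightarrow> E u = D (vertex_values q u)"
  shows "sg_renorm q \<rho> E v = \<rho> * glue3 D (vertex_values q v) (midpoint_values v)"
proof -
  have "E (\<lambda>x\<in>sg_V0 q. v (sg_map q i x)) = D (v (sg_map q i (q 1)), v (sg_map q i (q 2)), v (sg_map q i (q 3)))" for i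
    by (simp add: assms restrict_vertex_fun vertex_fun_in del: One_nat_def)
  then show ?thesis
    using sg_map_commute[of q 2 1] sg_map_commute[of q 3 1] sg_map_commute[of q 3 2]
    by (simp add: sg_renorm_def glue3_def vertex_values_def midpoint_values_def algebra_simps)
qed

text \<open>The midpoints differ from each other and from the vertices, so their values can be
  prescribed freely. Thus the infimum over extensions is an infimum over all triples.\<close>

lemma extension_exists:
  assumes u: "u \<in> Rfun (sg_V0 q)"
  shows "\<exists>v\<in>Rfun (sg_V1 q). restrict v (sg_V0 q) = u \<and> midpoint_values v = w"
proof -
  obtain a b c where w: "w = (a, b, c)" by (metis prod_cases3)
  let ?a = "sg_map q 2 (q 3)" and ?b = "sg_map q 1 (q 3)" and ?c = "sg_map q 1 (q 2)"
  define v where "v = (\<lambda>x\<in>sg_V1 q. if x = ?a then a else if x = ?b then b else if x = ?c then c else u x)"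
  have mid: "?b \<noteq> ?a" "?c \<noteq> ?a" "?c \<noteq> ?b"
    using vertex_distinct injD[OF inj_sg_map] sg_map_commute[of q] by metis+
  have not_mid: "q k \<noteq> ?a" "q k \<noteq> ?b" "q k \<noteq> ?c" if "k \<in> {1,2,3}" for k
    using equilateral_midpoint_not_vertex[OF q _ _ _ that, of 2 3] equilateral_midpoint_not_vertex[OF q _ _ _ that, of 1 3]
      equilateral_midpoint_not_vertex[OF q _ _ _ that, of 1 2] by auto
  have "v (q k) = u (q k)" if "k \<in> {1,2,3}" for k
    using that not_mid[OF that] by (auto simp: v_def sg_V1_eq)
  then have "restrict v (sg_V0 q) = u"
    using u by (auto simp: sg_V0_def restrict_def extensional_def fun_eq_iff)
  moreover have "midpoint_values v = w"
    using mid by (simp add: midpoint_values_def v_def sg_V1_eq w)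
  ultimately show ?thesis by (intro bexI[of _ v]) (simp_all add: v_def)
qed

lemma form_trace_sg_renorm:
  assumes D: "form3 p D" and E: "\<And>u. u \<in> Rfun (sg_V0 q) \<Longrightarrow> E u = D (vertex_values q u)"
    and "0 < \<rho>" and u: "u \<in> Rfun (sg_V0 q)"
  shows "form_trace (sg_V1 q) (sg_V0 q) (sg_renorm q \<rho> E) u = \<rho> * renorm3 D (vertex_values q u)"
proof -
  define w where "w = vertex_values q u"
  have "{sg_renorm q \<rho> E v | v. v \<in> Rfun (sg_V1 q) \<and> restrict v (sg_V0 q) = u} = range (\<lambda>t. \<rho> * glue3 D w t)"
    (is "?S = _")
  proof (intro equalityI subsetI)
    fix e assume "e \<in> ?S"
    then obtain v where v: "e = sg_renorm q \<rho> E v" "restrict v (sg_V0 q) = u" by blast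
    then have "vertex_values q v = w" using vertex_in by (auto simp: w_def vertex_values_def)
    then show "e \<in> range (\<lambda>t. \<rho> * glue3 D w t)" using v(1) by (auto simp: sg_renorm_eq_glue3[of E D, OF E])
  next
    fix e assume "e \<in> range (\<lambda>t. \<rho> * glue3 D w t)"
    then obtain t where t: "e = \<rho> * glue3 D w t" by blast
    obtain v where v: "v \<in> Rfun (sg_V1 q)" "restrict v (sg_V0 q) = u" "midpoint_values v = t"
      using extension_exists[OF u] by blast
    then have "vertex_values q v = w" using vertex_in by (auto simp: w_def vertex_values_def)
    then have "e = sg_renorm q \<rho> E v" using v(3) t by (simp add: sg_renorm_eq_glue3[of E D, OF E])
    then show "e \<in> ?S" using v by blast
  qed
  then have eq: "form_trace (sg_V1 q) (sg_V0 q) (sg_renorm q \<rho> E) u = (INF t. \<rho> * glue3 D w t)"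
    unfolding form_trace_def by simp
  have bdd: "bdd_below (range (\<lambda>t. \<rho> * glue3 D w t))"
    using glue3_nonneg[OF D] \<open>0 < \<rho>\<close> by (intro bdd_belowI2[of _ 0]) simp
  have "(INF t. \<rho> * glue3 D w t) / \<rho> \<le> renorm3 D w"
  proof (rule renorm3_greatest)
    fix t
    have "(INF t. \<rho> * glue3 D w t) \<le> \<rho> * glue3 D w t" by (rule cINF_lower[OF bdd]) simp
    then show "(INF t. \<rho> * glue3 D w t) / \<rho> \<le> glue3 D w t" using \<open>0 < \<rho>\<close> by (simp add: field_simps)
  qed
  moreover have "\<rho> * renorm3 D w \<le> (INF t. \<rho> * glue3 D w t)"
    using renorm3_le[OF D] \<open>0 < \<rho>\<close> by (intro cINF_greatest) auto
  ultimately show ?thesis unfolding eq w_def[symmetric] using \<open>0 < \<rho>\<close> by (simp add: field_simps)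
qed

lemma sg_eigenform_imp_eigen3:
  assumes "1 < p" "0 < \<rho>" "sg_eigenform p q \<rho> E"
  obtains D where "form3 p D" "nondegenerate3 D" "\<And>w. \<rho> * renorm3 D w = D w"
proof -
  have E: "resistance_form p (sg_V0 q) E"
    and eig: "\<And>u. u \<in> Rfun (sg_V0 q) \<Longrightarrow> form_trace (sg_V1 q) (sg_V0 q) (sg_renorm q \<rho> E) u = E u"
    using assms(3) by (auto simp: sg_eigenform_def)
  let ?D = "\<lambda>w. E (vertex_fun q w)"
  note D = resistance_form_imp_form3[OF assms(1) E]
  have "\<rho> * renorm3 ?D w = ?D w" for w
    using form_trace_sg_renorm[OF D(1) D(3) assms(2) vertex_fun_in, of w] eig[OF vertex_fun_in, of w] by simp
  then show ?thesis using that D(1,2) by blast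
qed

lemma eigen3_imp_sg_eigenform:
  assumes "form3 p D" "nondegenerate3 D" "\<And>w. \<rho> * renorm3 D w = D w" "0 < \<rho>"
  shows "sg_eigenform p q \<rho> (\<lambda>u. D (vertex_values q u))"
  unfolding sg_eigenform_def
  using form3_imp_resistance_form[OF assms(1,2)] form_trace_sg_renorm[OF assms(1) refl assms(4)] assms(3)
  by simp

text \<open>An isometry maps vertices to vertices and is injective, so it only permutes the
  arguments of \<open>D\<close>; the cases are enumerated.\<close>

lemma symmetric3_sg_invariant:
  assumes "symmetric3 D" shows "sg_invariant q (\<lambda>u. D (vertex_values q u))"
  unfolding sg_invariant_def
proof (intro ballI)
  fix u g assume g: "g \<in> sg_sym q"
  have gv: "g (q 1) = q 1 \<or> g (q 1) = q 2 \<or> g (q 1) = q 3" "g (q 2) = q 1 \<or> g (q 2) = q 2 \<or> g (q 2) = q 3"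
      "g (q 3) = q 1 \<or> g (q 3) = q 2 \<or> g (q 3) = q 3"
    by (rule vertex_cases[OF sg_sym_vertex[OF q g]], simp)+
  have "g (q i) \<noteq> g (q j)" if "i \<in> {1,2,3}" "j \<in> {1,2,3}" "i \<noteq> j" for i j
  proof -
    have "q i \<in> sg_gasket q" "q j \<in> sg_gasket q"
      using sg_gasket_between(1)[of q] that by (auto simp: sg_V0_def)
    then show ?thesis using g equilateral_distinct[OF q that] unfolding sg_sym_def bij_betw_def inj_on_def by blast
  qed
  from this[of 1 2] this[of 1 3] this[of 2 3]
  have ne: "g (q 1) \<noteq> g (q 2)" "g (q 1) \<noteq> g (q 3)" "g (q 2) \<noteq> g (q 3)" by auto
  have "D (u (g (q 1)), u (g (q 2)), u (g (q 3))) = D (u (q 1), u (q 2), u (q 3))"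
    using gv ne symmetric3_perm[OF assms, where x = "u (q 1)" and y = "u (q 2)" and z = "u (q 3)"]
    by (elim disjE) (simp_all del: One_nat_def)
  then show "D (vertex_values q (\<lambda>x\<in>sg_V0 q. u (g x))) = D (vertex_values q u)"
    using vertex_in by (simp add: vertex_values_def del: One_nat_def)
qed

end

theorem theorem3p6:
  fixes p :: real and q :: "nat \<Rightarrow> real^2"
  assumes "1 < p" and "equilateral q"
  shows "(\<exists>!\<rho>. 0 < \<rho> \<and> (\<exists>E. sg_eigenform p q \<rho> E)) \<and>
         (\<forall>\<rho>>0. (\<exists>E. sg_eigenform p q \<rho> E)
            \<longrightarrow> (\<exists>E. sg_eigenform p q \<rho> E \<and> sg_invariant q E))"
proof -
  obtain L D where "0 < L" and D: "form3 p D" "symmetric3 D" "1 \<le> D (1, 0, 0)" "\<And>w. renorm3 D w = L * D w"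
    using eigenform3_exists[OF assms(1)] by metis
  have nd: "nondegenerate3 D" using D(3) by (intro symmetric3_nondegenerate[OF D(1,2)]) simp
  define E where "E u = D (vertex_values q u)" for u
  have "sg_eigenform p q (1 / L) E"
    unfolding E_def[abs_def] using D(1) nd D(4) \<open>0 < L\<close> by (intro eigen3_imp_sg_eigenform[OF assms(2)]) auto
  moreover have "sg_invariant q E"
    unfolding E_def[abs_def] by (rule symmetric3_sg_invariant[OF assms(2) D(2)])
  moreover have "\<rho>1 \<le> \<rho>2"
    if pos: "0 < \<rho>1" "0 < \<rho>2" and eig: "sg_eigenform p q \<rho>1 E1" "sg_eigenform p q \<rho>2 E2" for \<rho>1 \<rho>2 E1 E2
  proof -
    obtain D1 where "form3 p D1" "nondegenerate3 D1" "\<And>w. \<rho>1 * renorm3 D1 w = D1 w"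
      using sg_eigenform_imp_eigen3[OF assms(2,1) pos(1) eig(1)] by metis
    moreover obtain D2 where "form3 p D2" "nondegenerate3 D2" "\<And>w. \<rho>2 * renorm3 D2 w = D2 w"
      using sg_eigenform_imp_eigen3[OF assms(2,1) pos(2) eig(2)] by metis
    ultimately show ?thesis using eigenvalue3_le[of p D2 \<rho>2 D1 \<rho>1] pos by simp
  qed
  \<comment> \<open>Every eigenvalue equals \<open>1 / L\<close> by antisymmetry, so the invariant
    form \<open>E\<close> serves for any \<open>\<rho>\<close> in the second claim.\<close>
  ultimately show ?thesis using \<open>0 < L\<close> by (metis antisym divide_pos_pos zero_less_one)
qed

end
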